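(* Let $\mathbb{T}$ be a semi-abelian theory and $G$ an internal groupoid in $\mathsf{Set}^{\mathbb{T}}$. Then the categories $\mathsf{Act}_{\mathsf{Gpd}(\mathsf{Set}^{\mathbb{T}})}/G$ and $\mathsf{Cov}_{\mathsf{Gpd}(\mathsf{Set}^{\mathbb{T}})}/G$ are equivalent.
   Context: An algebraic theory (in the sense of Lawvere) $\mathbb{T}$ is a category with objects $T^0,T,T^2,T^3,\dots$, where $T^n$ is the $n$-fold product of a distinguished object $T$ with itself, with chosen projections. Morphisms $T^n\to T$ are called $n$-ary operations; $0$-ary operations are called constants. A $\mathbb{T}$-algebra is a product-preserving functor $\mathbb{T}\to\mathsf{Set}$; equivalently, a set $A$ with a map $\tau=\tau_A\colon A^n\to A$ for each $n$-ary operation $\tau$, compatible with composition and projections in $\mathbb{T}$. A $\mathbb{T}$-homomorphism is a map commuting with all operations. The category of $\mathbb{T}$-algebras is $\mathsf{Set}^{\mathbb{T}}$. The theory $\mathbb{T}$ is called semi-abelian if $\mathsf{Set}^{\mathbb{T}}$ is a semi-abelian category (Barr-exact, protomodular, with finite coproducts and a zero object); equivalently (Bourn--Janelidze), $\mathbb{T}$ has a unique constant $e$ and, for some natural number $n$, has binary operations $\alpha_1,\dots,\alpha_n$ with $\alpha_i(X,X)=e$ and an $(n+1)$-ary operation $\theta$ with $\theta(\alpha_1(X,Y),\dots,\alpha_n(X,Y),Y)=X$. In a groupoid $G$ (the arrow set also denoted $G$) with source and target maps $s,t\colon G\to\mathsf{Ob}(G)$ and identity map $\epsilon\colon\mathsf{Ob}(G)\to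 G$, the composite $g\circ h$ is defined when $t(g)=s(h)$, with $s(g\circ h)=s(g)$ and $t(g\circ h)=t(h)$. An internal groupoid in $\mathsf{Set}^{\mathbb{T}}$ is a groupoid $G$ such that $\mathsf{Ob}(G)$ and $G$ are $\mathbb{T}$-algebras and $s$, $t$, $\epsilon$, the partial composition $G_t\times_s G\to G$ and the inversion are $\mathbb{T}$-homomorphisms. A morphism of internal groupoids is a groupoid morphism (functor) that is a $\mathbb{T}$-homomorphism on objects and on arrows. A groupoid morphism $p\colon H\to G$ is a covering morphism if for each $\tilde x\in\mathsf{Ob}(H)$ the restriction $\mathsf{St}_H\tilde x\to\mathsf{St}_G p(\tilde x)$ is bijective, where $\mathsf{St}_G x=\{g\in G: s(g)=x\}$. An action of an internal groupoid $G$ on a $\mathbb{T}$-algebra $A$ is a triple $(A,\omega,\varphi)$ with $\omega\colon A\to\mathsf{Ob}(G)$ and $\varphi\colon A_\omega\times_s G\to A$, $(a,g)\mapsto ag$ (the domain being the pullback $\{(a,g):\omega(a)=s(g)\}$) both $\mathbb{T}$-homomorphisms, such that $\omega(ag)=t(g)$, $a(g\circ h)=(ag)h$ and $a\,\epsilon(\omega(a))=a$ whenever defined. $\mathsf{Act}_{\mathsf{Gpd}(\mathsf{Set}^{\mathbb{T}})}/G$ is the category whose objects are the actions $(A,\omega,\varphi)$ of $G$ on $\mathbb{T}$-algebras and whose morphisms $(A,\omega,\varphi)\to(A',\omega',\varphi')$ are $\mathbb{T}$-homomorphisms $f\colon A\to A'$ with $\omega=\omega' f$ and $f(ag)=f(a)g$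 whenever $ag$ is defined. $\mathsf{Cov}_{\mathsf{Gpd}(\mathsf{Set}^{\mathbb{T}})}/G$ is the category whose objects are morphisms $p\colon H\to G$ of internal groupoids in $\mathsf{Set}^{\mathbb{T}}$ that are covering morphisms on the underlying groupoids, and whose morphisms from $p\colon H\to G$ to $q\colon K\to G$ are morphisms of internal groupoids $f\colon H\to K$ with $qf=p$. *)

theory Defs
  imports Main "HOL-Library.FuncSet"
begin

section \<open>Categories, functors, equivalences\<close>

text \<open>Hom-sets for different pairs of objects need not be disjoint, so composition and the action
  of a functor on morphisms take the objects as arguments. The morphism \<open>comp C X Y Z g f\<close> is
  \<open>g\<close> after \<open>f\<close>, for \<open>f : X \<rightarrow> Y\<close> and \<open>g : Y \<rightarrow> Z\<close>.\<close>

record ('o, 'a) cat =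
  obj :: "'o set"
  hom :: "'o \<Rightarrow> 'o \<Rightarrow> 'a set"
  ide :: "'o \<Rightarrow> 'a"
  comp :: "'o \<Rightarrow> 'o \<Rightarrow> 'o \<Rightarrow> 'a \<Rightarrow> 'a \<Rightarrow> 'a"

definition category :: "('o, 'a, 'z) cat_scheme \<Rightarrow> bool" where
  "category C \<longleftrightarrow>
     (\<forall>X\<in>obj C. ide C X \<in> hom C X X) \<and>
     (\<forall>X\<in>obj C. \<forall>Y\<in>obj C. \<forall>Z\<in>obj C. \<forall>f\<in>hom C X Y. \<forall>g\<in>hom C Y Z. comp C X Y Z g f \<in> hom C X Z) \<and>
     (\<forall>X\<in>obj C. \<forall>Y\<in>obj C. \<forall>f\<in>hom C X Y.
        comp C X X Y f (ide C X) = f \<and> comp C X Y Y (ide C Y) f = f) \<and>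
     (\<forall>W\<in>obj C. \<forall>X\<in>obj C. \<forall>Y\<in>obj C. \<forall>Z\<in>obj C. \<forall>f\<in>hom C W X. \<forall>g\<in>hom C X Y. \<forall>h\<in>hom C Y Z.
        comp C W X Z (comp C X Y Z h g) f = comp C W Y Z h (comp C W X Y g f))"

definition iso :: "('o, 'a, 'z) cat_scheme \<Rightarrow> 'o \<Rightarrow> 'o \<Rightarrow> 'a \<Rightarrow> bool" where
  "iso C X Y f \<longleftrightarrow> f \<in> hom C X Y \<and>
     (\<exists>g\<in>hom C Y X. comp C X Y X g f = ide C X \<and> comp C Y X Y f g = ide C Y)"

definition is_functor ::
  "('o, 'a, 'z) cat_scheme \<Rightarrow> ('p, 'b, 'y) cat_scheme \<Rightarrow> ('o \<Rightarrow> 'p) \<Rightarrow> ('o \<Rightarrow> 'o \<Rightarrow> 'a \<Rightarrow> 'b) \<Rightarrow> bool" where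
  "is_functor C D Fo Fa \<longleftrightarrow> category C \<and> category D \<and>
     (\<forall>X\<in>obj C. Fo X \<in> obj D) \<and>
     (\<forall>X\<in>obj C. \<forall>Y\<in>obj C. \<forall>f\<in>hom C X Y. Fa X Y f \<in> hom D (Fo X) (Fo Y)) \<and>
     (\<forall>X\<in>obj C. Fa X X (ide C X) = ide D (Fo X)) \<and>
     (\<forall>X\<in>obj C. \<forall>Y\<in>obj C. \<forall>Z\<in>obj C. \<forall>f\<in>hom C X Y. \<forall>g\<in>hom C Y Z.
        Fa X Z (comp C X Y Z g f) = comp D (Fo X) (Fo Y) (Fo Z) (Fa Y Z g) (Fa X Y f))"

definition natural_iso ::
  "('o, 'a, 'z) cat_scheme \<Rightarrow> ('p, 'b, 'y) cat_scheme \<Rightarrow> ('o \<Rightarrow> 'p) \<Rightarrow> ('o \<Rightarrow> 'o \<Rightarrow> 'a \<Rightarrow> 'b) \<Rightarrow>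
     ('o \<Rightarrow> 'p) \<Rightarrow> ('o \<Rightarrow> 'o \<Rightarrow> 'a \<Rightarrow> 'b) \<Rightarrow> ('o \<Rightarrow> 'b) \<Rightarrow> bool" where
  "natural_iso C D Fo Fa Go Ga \<eta> \<longleftrightarrow>
     (\<forall>X\<in>obj C. iso D (Fo X) (Go X) (\<eta> X)) \<and>
     (\<forall>X\<in>obj C. \<forall>Y\<in>obj C. \<forall>f\<in>hom C X Y.
        comp D (Fo X) (Fo Y) (Go Y) (\<eta> Y) (Fa X Y f) = comp D (Fo X) (Go X) (Go Y) (Ga X Y f) (\<eta> X))"

definition equivalent_categories ::
  "('o, 'a, 'z) cat_scheme \<Rightarrow> ('p, 'b, 'y) cat_scheme \<Rightarrow> bool" where
  "equivalent_categories C D \<longleftrightarrow>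
     (\<exists>Fo Fa Go Ga. is_functor C D Fo Fa \<and> is_functor D C Go Ga \<and>
        (\<exists>\<eta>. natural_iso C C (\<lambda>X. X) (\<lambda>X Y f. f)
                (\<lambda>X. Go (Fo X)) (\<lambda>X Y f. Ga (Fo X) (Fo Y) (Fa X Y f)) \<eta>) \<and>
        (\<exists>\<epsilon>. natural_iso D D (\<lambda>X. Fo (Go X)) (\<lambda>X Y f. Fa (Go X) (Go Y) (Ga X Y f))
                (\<lambda>X. X) (\<lambda>X Y f. f) \<epsilon>))"

section \<open>Semi-abelian categories\<close>

definition terminal :: "('o, 'a, 'z) cat_scheme \<Rightarrow> 'o \<Rightarrow> bool" where
  "terminal C Z \<longleftrightarrow> Z \<in> obj C \<and> (\<forall>X\<in>obj C. \<exists>!f. f \<in> hom C X Z)"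

definition initial :: "('o, 'a, 'z) cat_scheme \<Rightarrow> 'o \<Rightarrow> bool" where
  "initial C Z \<longleftrightarrow> Z \<in> obj C \<and> (\<forall>X\<in>obj C. \<exists>!f. f \<in> hom C Z X)"

definition is_pullback ::
  "('o, 'a, 'z) cat_scheme \<Rightarrow> 'o \<Rightarrow> 'o \<Rightarrow> 'o \<Rightarrow> 'a \<Rightarrow> 'a \<Rightarrow> 'o \<Rightarrow> 'a \<Rightarrow> 'a \<Rightarrow> bool" where
  "is_pullback C X Y Z f g P p q \<longleftrightarrow>
     X \<in> obj C \<and> Y \<in> obj C \<and> Z \<in> obj C \<and> P \<in> obj C \<and>
     f \<in> hom C X Z \<and> g \<in> hom C Y Z \<and> p \<in> hom C P X \<and> q \<in> hom C P Y \<and>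
     comp C P X Z f p = comp C P Y Z g q \<and>
     (\<forall>W\<in>obj C. \<forall>a\<in>hom C W X. \<forall>b\<in>hom C W Y. comp C W X Z f a = comp C W Y Z g b \<longrightarrow>
        (\<exists>!u. u \<in> hom C W P \<and> comp C W P X p u = a \<and> comp C W P Y q u = b))"

definition is_coproduct ::
  "('o, 'a, 'z) cat_scheme \<Rightarrow> 'o \<Rightarrow> 'o \<Rightarrow> 'o \<Rightarrow> 'a \<Rightarrow> 'a \<Rightarrow> bool" where
  "is_coproduct C X Y S i j \<longleftrightarrow>
     X \<in> obj C \<and> Y \<in> obj C \<and> S \<in> obj C \<and> i \<in> hom C X S \<and> j \<in> hom C Y S \<and>
     (\<forall>W\<in>obj C. \<forall>a\<in>hom C X W. \<forall>b\<in>hom C Y W.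
        \<exists>!u. u \<in> hom C S W \<and> comp C X S W u i = a \<and> comp C Y S W u j = b)"

definition is_coequalizer ::
  "('o, 'a, 'z) cat_scheme \<Rightarrow> 'o \<Rightarrow> 'o \<Rightarrow> 'a \<Rightarrow> 'a \<Rightarrow> 'o \<Rightarrow> 'a \<Rightarrow> bool" where
  "is_coequalizer C X Y f g Q q \<longleftrightarrow>
     X \<in> obj C \<and> Y \<in> obj C \<and> Q \<in> obj C \<and> f \<in> hom C X Y \<and> g \<in> hom C X Y \<and> q \<in> hom C Y Q \<and>
     comp C X Y Q q f = comp C X Y Q q g \<and>
     (\<forall>W\<in>obj C. \<forall>h\<in>hom C Y W. comp C X Y W h f = comp C X Y W h g \<longrightarrow>
        (\<exists>!u. u \<in> hom C Q W \<and> comp C Y Q W u q = h))"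

definition has_finite_limits :: "('o, 'a, 'z) cat_scheme \<Rightarrow> bool" where
  "has_finite_limits C \<longleftrightarrow> (\<exists>Z. terminal C Z) \<and>
     (\<forall>X\<in>obj C. \<forall>Y\<in>obj C. \<forall>Z\<in>obj C. \<forall>f\<in>hom C X Z. \<forall>g\<in>hom C Y Z. \<exists>P p q. is_pullback C X Y Z f g P p q)"

definition has_finite_coproducts :: "('o, 'a, 'z) cat_scheme \<Rightarrow> bool" where
  "has_finite_coproducts C \<longleftrightarrow> (\<exists>Z. initial C Z) \<and>
     (\<forall>X\<in>obj C. \<forall>Y\<in>obj C. \<exists>S i j. is_coproduct C X Y S i j)"

definition has_zero_object :: "('o, 'a, 'z) cat_scheme \<Rightarrow> bool" where
  "has_zero_object C \<longleftrightarrow> (\<exists>Z. initial C Z \<and> terminal C Z)"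

definition regular_epi :: "('o, 'a, 'z) cat_scheme \<Rightarrow> 'o \<Rightarrow> 'o \<Rightarrow> 'a \<Rightarrow> bool" where
  "regular_epi C Y Q q \<longleftrightarrow> (\<exists>X f g. is_coequalizer C X Y f g Q q)"

definition regular_category :: "('o, 'a, 'z) cat_scheme \<Rightarrow> bool" where
  "regular_category C \<longleftrightarrow> category C \<and> has_finite_limits C \<and>
     (\<forall>X Y f R r1 r2. is_pullback C X X Y f f R r1 r2 \<longrightarrow> (\<exists>Q q. is_coequalizer C R X r1 r2 Q q)) \<and>
     (\<forall>X Y Z f g P p q. is_pullback C X Y Z f g P p q \<and> regular_epi C X Z f \<longrightarrow> regular_epi C P Y q)"

definition internal_equivalence ::
  "('o, 'a, 'z) cat_scheme \<Rightarrow> 'o \<Rightarrow> 'o \<Rightarrow> 'a \<Rightarrow> 'a \<Rightarrow> bool" where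
  "internal_equivalence C X R r1 r2 \<longleftrightarrow>
     X \<in> obj C \<and> R \<in> obj C \<and> r1 \<in> hom C R X \<and> r2 \<in> hom C R X \<and>
     (\<forall>W\<in>obj C. \<forall>u\<in>hom C W R. \<forall>v\<in>hom C W R.
        comp C W R X r1 u = comp C W R X r1 v \<and> comp C W R X r2 u = comp C W R X r2 v \<longrightarrow> u = v) \<and>
     (\<exists>d\<in>hom C X R. comp C X R X r1 d = ide C X \<and> comp C X R X r2 d = ide C X) \<and>
     (\<exists>c\<in>hom C R R. comp C R R X r1 c = r2 \<and> comp C R R X r2 c = r1) \<and>
     (\<forall>P p q. is_pullback C R R X r2 r1 P p q \<longrightarrow>
        (\<exists>m\<in>hom C P R. comp C P R X r1 m = comp C P R X r1 p \<and> comp C P R X r2 m = comp C P R X r2 q))"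

definition barr_exact :: "('o, 'a, 'z) cat_scheme \<Rightarrow> bool" where
  "barr_exact C \<longleftrightarrow> regular_category C \<and>
     (\<forall>X R r1 r2. internal_equivalence C X R r1 r2 \<longrightarrow> (\<exists>Y f. is_pullback C X X Y f f R r1 r2))"

definition split_point :: "('o, 'a, 'z) cat_scheme \<Rightarrow> 'o \<Rightarrow> 'o \<Rightarrow> 'a \<Rightarrow> 'a \<Rightarrow> bool" where
  "split_point C Y A p s \<longleftrightarrow> Y \<in> obj C \<and> A \<in> obj C \<and> p \<in> hom C A Y \<and> s \<in> hom C Y A \<and>
     comp C Y A Y p s = ide C Y"

text \<open>Bourn's definition: pulling back points (split epimorphisms with a chosen section) along any
  \<open>v : X \<rightarrow> Y\<close> reflects isomorphisms. Below, \<open>f\<close> is a morphism of points over \<open>Y\<close> and \<open>u\<close> is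
  its image under the change-of-base functor.\<close>

definition protomodular :: "('o, 'a, 'z) cat_scheme \<Rightarrow> bool" where
  "protomodular C \<longleftrightarrow> category C \<and> has_finite_limits C \<and>
     (\<forall>X Y v A p s A' p' s' f P a b P' a' b' u.
        split_point C Y A p s \<and> split_point C Y A' p' s' \<and>
        f \<in> hom C A A' \<and> comp C A A' Y p' f = p \<and> comp C Y A A' f s = s' \<and>
        is_pullback C A X Y p v P a b \<and> is_pullback C A' X Y p' v P' a' b' \<and>
        u \<in> hom C P P' \<and> comp C P P' A' a' u = comp C P A A' f a \<and> comp C P P' X b' u = b \<and>
        iso C P P' u \<longrightarrow> iso C A A' f)"

definition semi_abelian_category :: "('o, 'a, 'z) cat_scheme \<Rightarrow> bool" where
  "semi_abelian_category C \<longleftrightarrow>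
     barr_exact C \<and> protomodular C \<and> has_finite_coproducts C \<and> has_zero_object C"

section \<open>Lawvere theories and their algebras\<close>

text \<open>The object \<open>T\<^sup>n\<close> is represented by the number \<open>n\<close>; \<open>proj n i\<close>, for \<open>i < n\<close>, is the
  chosen projection \<open>T\<^sup>n \<rightarrow> T\<close>. As \<open>T\<^sup>1\<close> is \<open>T\<close> itself, its projection is the identity.\<close>

record 'm lawvere = "(nat, 'm) cat" +
  proj :: "nat \<Rightarrow> nat \<Rightarrow> 'm"

definition lawvere_theory :: "'m lawvere \<Rightarrow> bool" where
  "lawvere_theory T \<longleftrightarrow> category T \<and> obj T = UNIV \<and>
     (\<forall>n. \<forall>i<n. proj T n i \<in> hom T n 1) \<and> proj T 1 0 = ide T 1 \<and>
     (\<forall>m n f. (\<forall>i<n. f i \<in> hom T m 1) \<longrightarrow>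
        (\<exists>!g. g \<in> hom T m n \<and> (\<forall>i<n. comp T m n 1 (proj T n i) g = f i)))"

definition tuples :: "nat \<Rightarrow> 'a set \<Rightarrow> 'a list set" where
  "tuples n S = {xs. length xs = n \<and> set xs \<subseteq> S}"

record ('m, 'a) alg =
  car :: "'a set"
  opn :: "nat \<Rightarrow> 'm \<Rightarrow> 'a list \<Rightarrow> 'a"

text \<open>Extensional function spaces \<open>\<rightarrow>\<^sub>E\<close> are used throughout, so that equality in HOL of algebras,
  homomorphisms, groupoids and actions coincides with mathematical equality.
  The composite of \<open>\<sigma> : T\<^sup>m \<rightarrow> T\<^sup>n\<close> and \<open>\<tau> : T\<^sup>n \<rightarrow> T\<close> is interpreted by inserting into \<open>\<tau>\<close> the
  \<open>n\<close> components \<open>proj n i \<circ> \<sigma>\<close> of \<open>\<sigma>\<close>.\<close>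

definition algebra :: "'m lawvere \<Rightarrow> ('m, 'a) alg \<Rightarrow> bool" where
  "algebra T A \<longleftrightarrow>
     (\<forall>n. opn A n \<in> hom T n 1 \<rightarrow>\<^sub>E (tuples n (car A) \<rightarrow>\<^sub>E car A)) \<and>
     (\<forall>n. \<forall>i<n. \<forall>xs\<in>tuples n (car A). opn A n (proj T n i) xs = xs ! i) \<and>
     (\<forall>m n. \<forall>\<sigma>\<in>hom T m n. \<forall>\<tau>\<in>hom T n 1. \<forall>xs\<in>tuples m (car A).
        opn A m (comp T m n 1 \<tau> \<sigma>) xs =
        opn A n \<tau> (map (\<lambda>i. opn A m (comp T m n 1 (proj T n i) \<sigma>) xs) [0..<n]))"

definition alg_hom :: "'m lawvere \<Rightarrow> ('m, 'a) alg \<Rightarrow> ('m, 'b) alg \<Rightarrow> ('a \<Rightarrow> 'b) set" where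
  "alg_hom T A B = {f \<in> car A \<rightarrow>\<^sub>E car B.
     \<forall>n. \<forall>\<tau>\<in>hom T n 1. \<forall>xs\<in>tuples n (car A). f (opn A n \<tau> xs) = opn B n \<tau> (map f xs)}"

definition alg_cat :: "'m lawvere \<Rightarrow> (('m, 'u) alg, 'u \<Rightarrow> 'u) cat" where
  "alg_cat T = \<lparr>obj = {A. algebra T A}, hom = alg_hom T,
     ide = (\<lambda>A. restrict (\<lambda>x. x) (car A)),
     comp = (\<lambda>A B C g f. compose (car A) g f)\<rparr>"

text \<open>The type \<open>'u\<close> plays the role of the universe of sets: the objects of Set are the subsets
  of \<open>'u\<close>. For infinite \<open>'u\<close> this universe is closed, up to bijection, under finite products,
  and it contains all free algebras on finitely many generators once \<open>'u\<close> is at least as large as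
  the set of operations of \<open>T\<close>. The argument \<open>U\<close> only serves to fix the type.\<close>

definition semi_abelian_theory :: "'u itself \<Rightarrow> 'm lawvere \<Rightarrow> bool" where
  "semi_abelian_theory U T \<longleftrightarrow> lawvere_theory T \<and>
     semi_abelian_category (alg_cat T :: (('m, 'u) alg, 'u \<Rightarrow> 'u) cat)"

definition pullback_alg ::
  "'m lawvere \<Rightarrow> ('m, 'a) alg \<Rightarrow> ('m, 'b) alg \<Rightarrow> ('a \<Rightarrow> 'c) \<Rightarrow> ('b \<Rightarrow> 'c) \<Rightarrow> ('m, 'a \<times> 'b) alg" where
  "pullback_alg T A B f g =
     (let P = {(a, b). a \<in> car A \<and> b \<in> car B \<and> f a = g b} in
      \<lparr>car = P,
       opn = (\<lambda>n. \<lambda>\<tau>\<in>hom T n 1. \<lambda>xs\<in>tuples n P.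
                (opn A n \<tau> (map fst xs), opn B n \<tau> (map snd xs)))\<rparr>)"

section \<open>Internal groupoids and covering morphisms\<close>

text \<open>Composition of arrows is written in diagrammatic order: \<open>cmp G (g, h)\<close> is defined when the
  target of \<open>g\<close> is the source of \<open>h\<close>.\<close>

record ('m, 'u) igpd =
  Ob :: "('m, 'u) alg"
  Ar :: "('m, 'u) alg"
  src :: "'u \<Rightarrow> 'u"
  tgt :: "'u \<Rightarrow> 'u"
  idt :: "'u \<Rightarrow> 'u"
  cmp :: "'u \<times> 'u \<Rightarrow> 'u"
  ivt :: "'u \<Rightarrow> 'u"

definition groupoid :: "('m, 'u) igpd \<Rightarrow> bool" where
  "groupoid G \<longleftrightarrow>
     src G \<in> car (Ar G) \<rightarrow> car (Ob G) \<and> tgt G \<in> car (Ar G) \<rightarrow> car (Ob G) \<and>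
     (\<forall>x\<in>car (Ob G). idt G x \<in> car (Ar G) \<and> src G (idt G x) = x \<and> tgt G (idt G x) = x) \<and>
     (\<forall>g\<in>car (Ar G). \<forall>h\<in>car (Ar G). tgt G g = src G h \<longrightarrow>
        cmp G (g, h) \<in> car (Ar G) \<and> src G (cmp G (g, h)) = src G g \<and> tgt G (cmp G (g, h)) = tgt G h) \<and>
     (\<forall>g\<in>car (Ar G). \<forall>h\<in>car (Ar G). \<forall>k\<in>car (Ar G). tgt G g = src G h \<and> tgt G h = src G k \<longrightarrow>
        cmp G (cmp G (g, h), k) = cmp G (g, cmp G (h, k))) \<and>
     (\<forall>g\<in>car (Ar G). cmp G (idt G (src G g), g) = g \<and> cmp G (g, idt G (tgt G g)) = g) \<and>
     (\<forall>g\<in>car (Ar G). ivt G g \<in> car (Ar G) \<and>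
        src G (ivt G g) = tgt G g \<and> tgt G (ivt G g) = src G g \<and>
        cmp G (g, ivt G g) = idt G (src G g) \<and> cmp G (ivt G g, g) = idt G (tgt G g))"

definition internal_groupoid :: "'m lawvere \<Rightarrow> ('m, 'u) igpd \<Rightarrow> bool" where
  "internal_groupoid T G \<longleftrightarrow> groupoid G \<and> algebra T (Ob G) \<and> algebra T (Ar G) \<and>
     src G \<in> alg_hom T (Ar G) (Ob G) \<and> tgt G \<in> alg_hom T (Ar G) (Ob G) \<and>
     idt G \<in> alg_hom T (Ob G) (Ar G) \<and>
     cmp G \<in> alg_hom T (pullback_alg T (Ar G) (Ar G) (tgt G) (src G)) (Ar G) \<and>
     ivt G \<in> alg_hom T (Ar G) (Ar G)"

text \<open>A morphism of internal groupoids is given by its maps on objects and on arrows.\<close>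

type_synonym 'u gpd_map = "('u \<Rightarrow> 'u) \<times> ('u \<Rightarrow> 'u)"

definition igpd_hom :: "'m lawvere \<Rightarrow> ('m, 'u) igpd \<Rightarrow> ('m, 'u) igpd \<Rightarrow> 'u gpd_map set" where
  "igpd_hom T H G = {(f0, f1). f0 \<in> alg_hom T (Ob H) (Ob G) \<and> f1 \<in> alg_hom T (Ar H) (Ar G) \<and>
     (\<forall>h\<in>car (Ar H). src G (f1 h) = f0 (src H h) \<and> tgt G (f1 h) = f0 (tgt H h)) \<and>
     (\<forall>x\<in>car (Ob H). f1 (idt H x) = idt G (f0 x)) \<and>
     (\<forall>h\<in>car (Ar H). \<forall>k\<in>car (Ar H). tgt H h = src H k \<longrightarrow>
        f1 (cmp H (h, k)) = cmp G (f1 h, f1 k))}"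

definition igpd_compose :: "('m, 'u) igpd \<Rightarrow> 'u gpd_map \<Rightarrow> 'u gpd_map \<Rightarrow> 'u gpd_map" where
  "igpd_compose H g f = (compose (car (Ob H)) (fst g) (fst f), compose (car (Ar H)) (snd g) (snd f))"

definition star :: "('m, 'u) igpd \<Rightarrow> 'u \<Rightarrow> 'u set" where
  "star G x = {g \<in> car (Ar G). src G g = x}"

definition covering :: "('m, 'u) igpd \<Rightarrow> ('m, 'u) igpd \<Rightarrow> 'u gpd_map \<Rightarrow> bool" where
  "covering H G p \<longleftrightarrow> (\<forall>x\<in>car (Ob H). bij_betw (snd p) (star H x) (star G (fst p x)))"

definition cov_cat ::
  "'m lawvere \<Rightarrow> ('m, 'u) igpd \<Rightarrow> (('m, 'u) igpd \<times> 'u gpd_map, 'u gpd_map) cat" where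
  "cov_cat T G = \<lparr>
     obj = {(H, p). internal_groupoid T H \<and> p \<in> igpd_hom T H G \<and> covering H G p},
     hom = (\<lambda>(H, p) (K, q). {f \<in> igpd_hom T H K. igpd_compose H q f = p}),
     ide = (\<lambda>(H, p). (restrict (\<lambda>x. x) (car (Ob H)), restrict (\<lambda>h. h) (car (Ar H)))),
     comp = (\<lambda>(H, p) (K, q) (L, r) g f. igpd_compose H g f)\<rparr>"

section \<open>Actions of internal groupoids\<close>

record ('m, 'u) act =
  acar :: "('m, 'u) alg"
  anc :: "'u \<Rightarrow> 'u"
  aact :: "'u \<times> 'u \<Rightarrow> 'u"

definition action :: "'m lawvere \<Rightarrow> ('m, 'u) igpd \<Rightarrow> ('m, 'u) act \<Rightarrow> bool" where
  "action T G X \<longleftrightarrow> algebra T (acar X) \<and>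
     anc X \<in> alg_hom T (acar X) (Ob G) \<and>
     aact X \<in> alg_hom T (pullback_alg T (acar X) (Ar G) (anc X) (src G)) (acar X) \<and>
     (\<forall>a\<in>car (acar X). \<forall>g\<in>car (Ar G). anc X a = src G g \<longrightarrow> anc X (aact X (a, g)) = tgt G g) \<and>
     (\<forall>a\<in>car (acar X). \<forall>g\<in>car (Ar G). \<forall>h\<in>car (Ar G). anc X a = src G g \<and> tgt G g = src G h \<longrightarrow>
        aact X (a, cmp G (g, h)) = aact X (aact X (a, g), h)) \<and>
     (\<forall>a\<in>car (acar X). aact X (a, idt G (anc X a)) = a)"

definition act_hom :: "'m lawvere \<Rightarrow> ('m, 'u) igpd \<Rightarrow> ('m, 'u) act \<Rightarrow> ('m, 'u) act \<Rightarrow> ('u \<Rightarrow> 'u) set" where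
  "act_hom T G X Y = {f \<in> alg_hom T (acar X) (acar Y).
     (\<forall>a\<in>car (acar X). anc X a = anc Y (f a)) \<and>
     (\<forall>a\<in>car (acar X). \<forall>g\<in>car (Ar G). anc X a = src G g \<longrightarrow> f (aact X (a, g)) = aact Y (f a, g))}"

definition act_cat :: "'m lawvere \<Rightarrow> ('m, 'u) igpd \<Rightarrow> (('m, 'u) act, 'u \<Rightarrow> 'u) cat" where
  "act_cat T G = \<lparr>obj = {X. action T G X}, hom = act_hom T G,
     ide = (\<lambda>X. restrict (\<lambda>a. a) (car (acar X))),
     comp = (\<lambda>X Y Z g f. compose (car (acar X)) g f)\<rparr>"

end

theory Submission
  imports Defs
begin

text \<open>An action of \<open>G\<close> on \<open>A\<close> has an action groupoid: its objects are the elements of \<open>A\<close>, its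
  arrows \<open>a \<rightarrow> ag\<close> are the pairs \<open>(a, g)\<close> with \<open>\<omega>(a) = s(g)\<close>, and the projection to \<open>G\<close> is a covering,
  because the arrows out of \<open>a\<close> are exactly the arrows of \<open>G\<close> out of \<open>\<omega>(a)\<close>. Conversely, in a
  covering \<open>p : H \<rightarrow> G\<close> an arrow \<open>g\<close> out of \<open>p(x)\<close> has a unique lift out of \<open>x\<close>, and \<open>G\<close> acts on
  \<open>Ob(H)\<close> by sending \<open>(x, g)\<close> to the target of this lift. The groupoid laws of an
  action groupoid follow from the action laws, and the action laws for a covering from the uniqueness
  of lifts, exactly as for groupoids in sets.

  What has to be added is that every map in sight is a \<open>T\<close>-homomorphism. For the action groupoid, its
  algebra of arrows is a pullback of algebras, so a map into it is a homomorphism as soon as its two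
  components are, and each structure map has components composed of given homomorphisms. For the
  covering, being a covering means that \<open>h \<mapsto> (s(h), p(h))\<close> is a bijection from the arrows of \<open>H\<close> onto
  the pullback of \<open>Ob(H)\<close> and the arrows of \<open>G\<close> over \<open>Ob(G)\<close>; it is a homomorphism, and the inverse
  of a bijective homomorphism is again one. This inverse is the lifting map (\<open>preserves_lift\<close>).

  Starting from an action, the two constructions give back the same action
  (\<open>lifting_action_of_action_groupoid\<close>); starting from a covering, they give an isomorphic one, with the
  lifting map as the comparison (\<open>counit_iso\<close>, \<open>counit_natural\<close>). The arrows of an action groupoid must be
  elements of the fixed universe \<open>'u\<close>, so pairs are stored through an injection of \<open>'u \<times> 'u\<close> into \<open>'u\<close>,
  which exists since \<open>'u\<close> is infinite.\<close>

section \<open>Operation-preserving maps\<close>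

definition op_closed :: "'m lawvere \<Rightarrow> ('m, 'a) alg \<Rightarrow> bool" where
  "op_closed T A \<longleftrightarrow> (\<forall>n. \<forall>\<tau>\<in>hom T n 1. \<forall>xs\<in>tuples n (car A). opn A n \<tau> xs \<in> car A)"

text \<open>A homomorphism without the extensionality that \<open>alg_hom\<close> demands: composites and pairings of such
  maps are plain lambda terms, and \<open>restrict\<close> is applied once, at the end
  (\<open>preserves_restrict\<close>).\<close>

definition preserves :: "'m lawvere \<Rightarrow> ('m, 'a) alg \<Rightarrow> ('m, 'b) alg \<Rightarrow> ('a \<Rightarrow> 'b) \<Rightarrow> bool" where
  "preserves T A B f \<longleftrightarrow> f \<in> car A \<rightarrow> car B \<and>
     (\<forall>n. \<forall>\<tau>\<in>hom T n 1. \<forall>xs\<in>tuples n (car A). f (opn A n \<tau> xs) = opn B n \<tau> (map f xs))"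

lemma map_tuples: "f \<in> S \<rightarrow> R \<Longrightarrow> xs \<in> tuples n S \<Longrightarrow> map f xs \<in> tuples n R"
  by (auto simp: tuples_def)

lemma tuples_nth: "xs \<in> tuples n S \<Longrightarrow> i < n \<Longrightarrow> xs ! i \<in> S"
  by (auto simp: tuples_def)

lemma op_closedD: "op_closed T A \<Longrightarrow> \<tau> \<in> hom T n 1 \<Longrightarrow> xs \<in> tuples n (car A) \<Longrightarrow> opn A n \<tau> xs \<in> car A"
  by (auto simp: op_closed_def)

lemma algebra_op_closed: "algebra T A \<Longrightarrow> op_closed T A"
  unfolding algebra_def op_closed_def by (meson PiE_mem)

lemma preserves_in: "preserves T A B f \<Longrightarrow> x \<in> car A \<Longrightarrow> f x \<in> car B"
  by (auto simp: preserves_def)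

lemma preserves_op:
  "preserves T A B f \<Longrightarrow> \<tau> \<in> hom T n 1 \<Longrightarrow> xs \<in> tuples n (car A) \<Longrightarrow>
     f (opn A n \<tau> xs) = opn B n \<tau> (map f xs)"
  by (auto simp: preserves_def)

lemma preserves_tuples: "preserves T A B f \<Longrightarrow> xs \<in> tuples n (car A) \<Longrightarrow> map f xs \<in> tuples n (car B)"
  by (auto simp: preserves_def intro: map_tuples)

lemma alg_hom_iff: "f \<in> alg_hom T A B \<longleftrightarrow> preserves T A B f \<and> f \<in> extensional (car A)"
  by (auto simp: alg_hom_def preserves_def PiE_def)

lemma preserves_cong:
  assumes "op_closed T A" and f: "preserves T A B f" and eq: "\<And>x. x \<in> car A \<Longrightarrow> f' x = f x"
  shows "preserves T A B f'"
proof -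
  have map_eq: "map f' xs = map f xs" if "xs \<in> tuples n (car A)" for n xs
    using that eq by (auto simp: tuples_def)
  have "f' (opn A n \<tau> xs) = opn B n \<tau> (map f' xs)" if "\<tau> \<in> hom T n 1" "xs \<in> tuples n (car A)" for n \<tau> xs
    unfolding map_eq[OF that(2)] eq[OF op_closedD[OF assms(1) that]] by (rule preserves_op[OF f that])
  moreover have "f' \<in> car A \<rightarrow> car B"
    using preserves_in[OF f] eq by simp
  ultimately show ?thesis
    by (simp add: preserves_def)
qed

lemma preserves_restrict:
  "op_closed T A \<Longrightarrow> preserves T A B f \<Longrightarrow> restrict f (car A) \<in> alg_hom T A B"
  unfolding alg_hom_iff by (auto intro: preserves_cong)

lemma preserves_ident: "preserves T A A (\<lambda>x. x)"
  by (auto simp: preserves_def)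

lemma preserves_comp:
  assumes f: "preserves T A B f" and g: "preserves T B C g"
  shows "preserves T A C (\<lambda>x. g (f x))"
proof -
  have "g (f (opn A n \<tau> xs)) = opn C n \<tau> (map (\<lambda>x. g (f x)) xs)"
    if "\<tau> \<in> hom T n 1" "xs \<in> tuples n (car A)" for n \<tau> xs
    using preserves_op[OF f that] preserves_op[OF g that(1) preserves_tuples[OF f that(2)]]
    by (simp add: o_def)
  then show ?thesis
    using preserves_in[OF f] preserves_in[OF g] by (simp add: preserves_def Pi_iff)
qed

lemma alg_hom_compose:
  assumes "op_closed T A" "f \<in> alg_hom T A B" "g \<in> alg_hom T B C"
  shows "compose (car A) g f \<in> alg_hom T A C"
  unfolding compose_def
  using assms by (intro preserves_restrict preserves_comp[of T A B f C g]) (auto simp: alg_hom_iff)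

text \<open>Apply \<open>l\<close> to \<open>k (\<tau> (l y\<^sub>1, \<dots>)) = \<tau> (k (l y\<^sub>1), \<dots>) = \<tau> (y\<^sub>1, \<dots>)\<close>.\<close>

lemma preserves_inverse:
  assumes A: "op_closed T A" and k: "preserves T A B k"
    and l: "l \<in> car B \<rightarrow> car A"
    and lk: "\<And>x. x \<in> car A \<Longrightarrow> l (k x) = x" and kl: "\<And>y. y \<in> car B \<Longrightarrow> k (l y) = y"
  shows "preserves T B A l"
proof -
  have "l (opn B n \<tau> ys) = opn A n \<tau> (map l ys)"
    if \<tau>: "\<tau> \<in> hom T n 1" and ys: "ys \<in> tuples n (car B)" for n \<tau> ys
  proof -
    have l_ys: "map l ys \<in> tuples n (car A)"
      using l ys by (rule map_tuples)
    have "map k (map l ys) = ys"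
      using ys kl by (auto simp: tuples_def intro!: map_idI)
    then have "k (opn A n \<tau> (map l ys)) = opn B n \<tau> ys"
      using preserves_op[OF k \<tau> l_ys] by simp
    then show ?thesis
      using lk[OF op_closedD[OF A \<tau> l_ys]] by simp
  qed
  then show ?thesis
    using l by (simp add: preserves_def)
qed

section \<open>Pullbacks and transport of algebras\<close>

text \<open>The algebra laws are equations between values of operations, so they may be checked after
  applying a jointly injective pair of operation-preserving maps into structures where they are known. This gives pullbacks (with both projections) and transported structures (with the inverse
  of the transport, taken twice).\<close>

lemma algebra_if_jointly_injective:
  assumes T: "lawvere_theory T" and A: "algebra T A" and B: "algebra T B"
    and C: "op_closed T C"
      "\<And>n. opn C n \<in> extensional (hom T n 1)"
      "\<And>n \<tau>. \<tau> \<in> hom T n 1 \<Longrightarrow> opn C n \<tau> \<in> extensional (tuples n (car C))"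
    and u: "preserves T C A u" and v: "preserves T C B v"
    and inj: "\<And>x y. x \<in> car C \<Longrightarrow> y \<in> car C \<Longrightarrow> u x = u y \<Longrightarrow> v x = v y \<Longrightarrow> x = y"
  shows "algebra T C"
proof -
  note clos = op_closedD[OF C(1)]
  have projT: "proj T n i \<in> hom T n 1" if "i < n" for n i
    using T that by (simp add: lawvere_theory_def)
  have compT: "comp T m n 1 \<tau> \<sigma> \<in> hom T m 1" if "\<sigma> \<in> hom T m n" "\<tau> \<in> hom T n 1" for m n \<sigma> \<tau>
    using T that by (auto simp: lawvere_theory_def category_def)
  have proj_law: "w (opn C n (proj T n i) xs) = w (xs ! i)"
    if w: "preserves T C D w" and D: "algebra T D" and i: "i < n" and xs: "xs \<in> tuples n (car C)"
    for D :: "('a, 'e) alg" and w n i xs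
  proof -
    have "opn D n (proj T n i) (map w xs) = map w xs ! i"
      using D i preserves_tuples[OF w xs] by (auto simp: algebra_def)
    then show ?thesis
      using preserves_op[OF w projT[OF i] xs] i xs by (simp add: tuples_def)
  qed
  have comp_law: "w (opn C m (comp T m n 1 \<tau> \<sigma>) xs) =
      w (opn C n \<tau> (map (\<lambda>i. opn C m (comp T m n 1 (proj T n i) \<sigma>) xs) [0..<n]))"
    and ys: "map (\<lambda>i. opn C m (comp T m n 1 (proj T n i) \<sigma>) xs) [0..<n] \<in> tuples n (car C)"
    if w: "preserves T C D w" and D: "algebra T D"
      and \<sigma>: "\<sigma> \<in> hom T m n" and \<tau>: "\<tau> \<in> hom T n 1" and xs: "xs \<in> tuples m (car C)"
    for D :: "('a, 'e) alg" and w m n \<sigma> \<tau> xs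
  proof -
    let ?ys = "map (\<lambda>i. opn C m (comp T m n 1 (proj T n i) \<sigma>) xs) [0..<n]"
    show ys: "?ys \<in> tuples n (car C)"
      using clos[OF compT[OF \<sigma> projT] xs] by (auto simp: tuples_def)
    have "map w ?ys = map (\<lambda>i. opn D m (comp T m n 1 (proj T n i) \<sigma>) (map w xs)) [0..<n]"
      using preserves_op[OF w compT[OF \<sigma> projT] xs] by (simp add: o_def)
    moreover have "opn D m (comp T m n 1 \<tau> \<sigma>) (map w xs) =
        opn D n \<tau> (map (\<lambda>i. opn D m (comp T m n 1 (proj T n i) \<sigma>) (map w xs)) [0..<n])"
      using D \<sigma> \<tau> preserves_tuples[OF w xs] by (auto simp: algebra_def)
    ultimately show "w (opn C m (comp T m n 1 \<tau> \<sigma>) xs) = w (opn C n \<tau> ?ys)"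
      using preserves_op[OF w compT[OF \<sigma> \<tau>] xs] preserves_op[OF w \<tau> ys] by metis
  qed
  show ?thesis
    unfolding algebra_def
  proof (intro conjI allI ballI impI)
    fix n show "opn C n \<in> hom T n 1 \<rightarrow>\<^sub>E (tuples n (car C) \<rightarrow>\<^sub>E car C)"
      using C clos by (auto simp: PiE_def)
  next
    fix n i xs assume h: "i < n" "xs \<in> tuples n (car C)"
    show "opn C n (proj T n i) xs = xs ! i"
      using inj clos[OF projT[OF h(1)] h(2)] tuples_nth[OF h(2,1)]
        proj_law[OF u A h] proj_law[OF v B h] by blast
  next
    fix m n \<sigma> \<tau> xs assume h: "\<sigma> \<in> hom T m n" "\<tau> \<in> hom T n 1" "xs \<in> tuples m (car C)"
    show "opn C m (comp T m n 1 \<tau> \<sigma>) xs =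
        opn C n \<tau> (map (\<lambda>i. opn C m (comp T m n 1 (proj T n i) \<sigma>) xs) [0..<n])"
      using inj clos[OF compT[OF h(1,2)] h(3)] clos[OF h(2) ys[OF u A h]]
        comp_law[OF u A h] comp_law[OF v B h] by blast
  qed
qed

lemma car_pullback:
  "car (pullback_alg T A B f g) = {(a, b). a \<in> car A \<and> b \<in> car B \<and> f a = g b}"
  by (simp add: pullback_alg_def Let_def)

lemma opn_pullback:
  "\<tau> \<in> hom T n 1 \<Longrightarrow> xs \<in> tuples n (car (pullback_alg T A B f g)) \<Longrightarrow>
     opn (pullback_alg T A B f g) n \<tau> xs = (opn A n \<tau> (map fst xs), opn B n \<tau> (map snd xs))"
  by (simp add: pullback_alg_def Let_def)

lemma preserves_fst: "preserves T (pullback_alg T A B f g) A fst"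
  by (auto simp: preserves_def opn_pullback) (auto simp: car_pullback)

lemma preserves_snd: "preserves T (pullback_alg T A B f g) B snd"
  by (auto simp: preserves_def opn_pullback) (auto simp: car_pullback)

text \<open>The universal property of the pullback.\<close>

lemma preserves_pair:
  assumes u: "preserves T W A u" and v: "preserves T W B v"
    and eq: "\<And>w. w \<in> car W \<Longrightarrow> f (u w) = g (v w)"
  shows "preserves T W (pullback_alg T A B f g) (\<lambda>w. (u w, v w))"
proof -
  have mem: "(\<lambda>w. (u w, v w)) \<in> car W \<rightarrow> car (pullback_alg T A B f g)"
    using preserves_in[OF u] preserves_in[OF v] eq by (auto simp: car_pullback)
  show ?thesis
    using preserves_op[OF u] preserves_op[OF v] map_tuples[OF mem]
    by (auto simp: preserves_def mem opn_pullback o_def)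
qed

lemma op_closed_pullback:
  assumes A: "op_closed T A" and B: "op_closed T B"
    and f: "preserves T A C f" and g: "preserves T B C g"
  shows "op_closed T (pullback_alg T A B f g)"
  unfolding op_closed_def
proof (intro allI ballI)
  fix n \<tau> xs assume h: "\<tau> \<in> hom T n 1" "xs \<in> tuples n (car (pullback_alg T A B f g))"
  note t = preserves_tuples[OF preserves_fst h(2)] preserves_tuples[OF preserves_snd h(2)]
  have fg: "map f (map fst xs) = map g (map snd xs)"
    using h(2) by (auto simp: tuples_def car_pullback)
  show "opn (pullback_alg T A B f g) n \<tau> xs \<in> car (pullback_alg T A B f g)"
    unfolding opn_pullback[OF h]
    using op_closedD[OF A h(1) t(1)] op_closedD[OF B h(1) t(2)]
      preserves_op[OF f h(1) t(1)] preserves_op[OF g h(1) t(2)]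
    unfolding fg by (simp add: car_pullback)
qed

lemma algebra_pullback:
  assumes "lawvere_theory T" "algebra T A" "algebra T B" "preserves T A C f" "preserves T B C g"
  shows "algebra T (pullback_alg T A B f g)"
  by (rule algebra_if_jointly_injective[OF assms(1-3) _ _ _ preserves_fst preserves_snd])
    (use assms in \<open>auto intro: op_closed_pullback algebra_op_closed simp: prod_eq_iff\<close>,
     auto simp: pullback_alg_def Let_def)

text \<open>Transport of structure along an injection \<open>j\<close>.\<close>

definition image_alg :: "'m lawvere \<Rightarrow> ('a \<Rightarrow> 'b) \<Rightarrow> ('m, 'a) alg \<Rightarrow> ('m, 'b) alg" where
  "image_alg T j A = \<lparr>car = j ` car A,
     opn = (\<lambda>n. \<lambda>\<tau>\<in>hom T n 1. \<lambda>xs\<in>tuples n (j ` car A). j (opn A n \<tau> (map (inv j) xs)))\<rparr>"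

lemma preserves_image:
  assumes j: "inj j"
  shows "preserves T A (image_alg T j A) j"
  using map_tuples[of j "car A" "j ` car A"] j
  by (auto simp: preserves_def image_alg_def)

lemma op_closed_image:
  assumes "inj j" "op_closed T A"
  shows "op_closed T (image_alg T j A)"
proof -
  have "inv j \<in> j ` car A \<rightarrow> car A"
    using assms(1) by auto
  then show ?thesis
    using map_tuples op_closedD[OF assms(2)] by (fastforce simp: op_closed_def image_alg_def)
qed

lemma preserves_inv_image:
  assumes j: "inj j" and A: "op_closed T A"
  shows "preserves T (image_alg T j A) A (inv j)"
  by (rule preserves_inverse[OF A preserves_image[OF j]]) (use j in \<open>auto simp: image_alg_def\<close>)

lemma algebra_image:
  assumes T: "lawvere_theory T" and A: "algebra T A" and j: "inj j"
  shows "algebra T (image_alg T j A)"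
proof -
  note r = preserves_inv_image[OF j algebra_op_closed[OF A]]
  show ?thesis
    by (rule algebra_if_jointly_injective[OF T A A op_closed_image[OF j algebra_op_closed[OF A]] _ _ r r])
      (use j in \<open>auto simp: image_alg_def\<close>)
qed

section \<open>Internal functors\<close>

lemma gpdD:
  assumes "groupoid H"
  shows "g \<in> car (Ar H) \<Longrightarrow> src H g \<in> car (Ob H)"
    and "g \<in> car (Ar H) \<Longrightarrow> tgt H g \<in> car (Ob H)"
    and "x \<in> car (Ob H) \<Longrightarrow> idt H x \<in> car (Ar H)"
    and "x \<in> car (Ob H) \<Longrightarrow> src H (idt H x) = x"
    and "x \<in> car (Ob H) \<Longrightarrow> tgt H (idt H x) = x"
    and "g \<in> car (Ar H) \<Longrightarrow> h \<in> car (Ar H) \<Longrightarrow> tgt H g = src H h \<Longrightarrow> cmp H (g, h) \<in> car (Ar H)"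
    and "g \<in> car (Ar H) \<Longrightarrow> h \<in> car (Ar H) \<Longrightarrow> tgt H g = src H h \<Longrightarrow> src H (cmp H (g, h)) = src H g"
    and "g \<in> car (Ar H) \<Longrightarrow> h \<in> car (Ar H) \<Longrightarrow> tgt H g = src H h \<Longrightarrow> tgt H (cmp H (g, h)) = tgt H h"
    and "g \<in> car (Ar H) \<Longrightarrow> h \<in> car (Ar H) \<Longrightarrow> k \<in> car (Ar H) \<Longrightarrow> tgt H g = src H h \<Longrightarrow> tgt H h = src H k \<Longrightarrow>
        cmp H (cmp H (g, h), k) = cmp H (g, cmp H (h, k))"
    and "g \<in> car (Ar H) \<Longrightarrow> cmp H (idt H (src H g), g) = g"
    and "g \<in> car (Ar H) \<Longrightarrow> cmp H (g, idt H (tgt H g)) = g"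
    and "g \<in> car (Ar H) \<Longrightarrow> ivt H g \<in> car (Ar H)"
    and "g \<in> car (Ar H) \<Longrightarrow> src H (ivt H g) = tgt H g"
    and "g \<in> car (Ar H) \<Longrightarrow> tgt H (ivt H g) = src H g"
    and "g \<in> car (Ar H) \<Longrightarrow> cmp H (g, ivt H g) = idt H (src H g)"
    and "g \<in> car (Ar H) \<Longrightarrow> cmp H (ivt H g, g) = idt H (tgt H g)"
  using assms unfolding groupoid_def Pi_iff by blast+

lemma igpd_homD:
  assumes "f \<in> igpd_hom T H K"
  shows "preserves T (Ob H) (Ob K) (fst f)" "preserves T (Ar H) (Ar K) (snd f)"
    "fst f \<in> extensional (car (Ob H))" "snd f \<in> extensional (car (Ar H))"
    "x \<in> car (Ob H) \<Longrightarrow> fst f x \<in> car (Ob K)" "h \<in> car (Ar H) \<Longrightarrow> snd f h \<in> car (Ar K)"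
    "h \<in> car (Ar H) \<Longrightarrow> src K (snd f h) = fst f (src H h)"
    "h \<in> car (Ar H) \<Longrightarrow> tgt K (snd f h) = fst f (tgt H h)"
    "x \<in> car (Ob H) \<Longrightarrow> snd f (idt H x) = idt K (fst f x)"
    "h \<in> car (Ar H) \<Longrightarrow> k \<in> car (Ar H) \<Longrightarrow> tgt H h = src H k \<Longrightarrow>
        snd f (cmp H (h, k)) = cmp K (snd f h, snd f k)"
  using assms by (auto simp: igpd_hom_def alg_hom_iff preserves_def split_beta)

lemma igpd_homI:
  assumes "fst f \<in> alg_hom T (Ob H) (Ob K)" "snd f \<in> alg_hom T (Ar H) (Ar K)"
    "\<And>h. h \<in> car (Ar H) \<Longrightarrow> src K (snd f h) = fst f (src H h)"
    "\<And>h. h \<in> car (Ar H) \<Longrightarrow> tgt K (snd f h) = fst f (tgt H h)"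
    "\<And>x. x \<in> car (Ob H) \<Longrightarrow> snd f (idt H x) = idt K (fst f x)"
    "\<And>h k. h \<in> car (Ar H) \<Longrightarrow> k \<in> car (Ar H) \<Longrightarrow> tgt H h = src H k \<Longrightarrow>
        snd f (cmp H (h, k)) = cmp K (snd f h, snd f k)"
  shows "f \<in> igpd_hom T H K"
  using assms by (auto simp: igpd_hom_def split_beta)

lemma gpd_map_eqI:
  assumes "fst f \<in> extensional A" "fst g \<in> extensional A" "snd f \<in> extensional B" "snd g \<in> extensional B"
    "\<And>x. x \<in> A \<Longrightarrow> fst f x = fst g x" "\<And>x. x \<in> B \<Longrightarrow> snd f x = snd g x"
  shows "f = g"
  using assms by (auto simp: prod_eq_iff intro: extensionalityI)

lemma igpd_compose_simps:
  "x \<in> car (Ob H) \<Longrightarrow> fst (igpd_compose H g f) x = fst g (fst f x)"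
  "h \<in> car (Ar H) \<Longrightarrow> snd (igpd_compose H g f) h = snd g (snd f h)"
  "fst (igpd_compose H g f) \<in> extensional (car (Ob H))"
  "snd (igpd_compose H g f) \<in> extensional (car (Ar H))"
  by (simp_all add: igpd_compose_def compose_eq)

lemma igpd_compose_hom:
  assumes H: "internal_groupoid T H" and f: "f \<in> igpd_hom T H K" and g: "g \<in> igpd_hom T K L"
  shows "igpd_compose H g f \<in> igpd_hom T H L"
proof -
  have gpd: "groupoid H" and cl: "op_closed T (Ob H)" "op_closed T (Ar H)"
    using H by (auto simp: internal_groupoid_def intro: algebra_op_closed)
  note fD = igpd_homD[OF f] and gD = igpd_homD[OF g] and HD = gpdD[OF gpd]
  have "fst (igpd_compose H g f) \<in> alg_hom T (Ob H) (Ob L)"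
    "snd (igpd_compose H g f) \<in> alg_hom T (Ar H) (Ar L)"
    unfolding igpd_compose_def fst_conv snd_conv
    using cl fD(1-4) gD(1-4) by (auto simp: alg_hom_iff[of "fst _"] alg_hom_iff[of "snd _"] intro!: alg_hom_compose)
  then show ?thesis
    by (rule igpd_homI) (simp_all add: igpd_compose_simps HD fD gD)
qed

definition igpd_ident :: "('m, 'u) igpd \<Rightarrow> 'u gpd_map" where
  "igpd_ident H = (restrict (\<lambda>x. x) (car (Ob H)), restrict (\<lambda>h. h) (car (Ar H)))"

lemma igpd_ident_hom:
  assumes H: "internal_groupoid T H"
  shows "igpd_ident H \<in> igpd_hom T H H"
proof -
  have gpd: "groupoid H" and cl: "op_closed T (Ob H)" "op_closed T (Ar H)"
    using H by (auto simp: internal_groupoid_def intro: algebra_op_closed)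
  show ?thesis
    by (rule igpd_homI)
      (use cl in \<open>simp_all add: igpd_ident_def gpdD[OF gpd] preserves_restrict preserves_ident\<close>)
qed

lemma igpd_compose_laws:
  fixes H K :: "('m, 'u) igpd"
  assumes "f \<in> igpd_hom T H K"
  shows "igpd_compose H f (igpd_ident H) = f" "igpd_compose H (igpd_ident K) f = f"
    "igpd_compose H (igpd_compose K g' g) f = igpd_compose H g' (igpd_compose H g f)"
  by (rule gpd_map_eqI[where A = "car (Ob H)" and B = "car (Ar H)"],
      use igpd_homD[OF assms] in \<open>auto simp: igpd_compose_simps igpd_ident_def\<close>)+

section \<open>The action groupoid\<close>

text \<open>The injection \<open>enc\<close> makes pairs into elements of the universe \<open>'u\<close>, in which the arrows of an
  internal groupoid must lie.\<close>

locale encoded_internal_groupoid =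
  fixes T :: "'m lawvere" and G :: "('m, 'u) igpd" and enc :: "'u \<times> 'u \<Rightarrow> 'u"
  assumes lawvere: "lawvere_theory T" and internal: "internal_groupoid T G" and inj_enc: "inj enc"
begin

abbreviation dec :: "'u \<Rightarrow> 'u \<times> 'u" where "dec \<equiv> inv enc"

lemma dec_enc [simp]: "dec (enc x) = x"
  using inj_enc by simp

lemma enc_eq [simp]: "enc x = enc y \<longleftrightarrow> x = y"
  using inj_enc by (auto dest: injD)

definition action_arrows :: "('m, 'u) act \<Rightarrow> ('m, 'u) alg" where
  "action_arrows X = image_alg T enc (pullback_alg T (acar X) (Ar G) (anc X) (src G))"

definition action_groupoid :: "('m, 'u) act \<Rightarrow> ('m, 'u) igpd" where
  "action_groupoid X =
    \<lparr>Ob = acar X, Ar = action_arrows X,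
     src = (\<lambda>e\<in>car (action_arrows X). fst (dec e)),
     tgt = (\<lambda>e\<in>car (action_arrows X). aact X (dec e)),
     idt = (\<lambda>a\<in>car (acar X). enc (a, idt G (anc X a))),
     cmp = (\<lambda>(e, e') \<in> {(e, e'). e \<in> car (action_arrows X) \<and> e' \<in> car (action_arrows X) \<and>
                           aact X (dec e) = fst (dec e')}.
              enc (fst (dec e), cmp G (snd (dec e), snd (dec e')))),
     ivt = (\<lambda>e\<in>car (action_arrows X). enc (aact X (dec e), ivt G (snd (dec e))))\<rparr>"

definition action_projection :: "('m, 'u) act \<Rightarrow> 'u gpd_map" where
  "action_projection X = (anc X, \<lambda>e\<in>car (action_arrows X). snd (dec e))"

definition action_map :: "('m, 'u) act \<Rightarrow> ('u \<Rightarrow> 'u) \<Rightarrow> 'u gpd_map" where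
  "action_map X f = (f, \<lambda>e\<in>car (action_arrows X). enc (f (fst (dec e)), snd (dec e)))"

lemma car_action_arrows:
  "e \<in> car (action_arrows X) \<longleftrightarrow>
     (\<exists>a g. e = enc (a, g) \<and> a \<in> car (acar X) \<and> g \<in> car (Ar G) \<and> anc X a = src G g)"
  by (auto simp: action_arrows_def image_alg_def car_pullback)

lemma action_groupoid_simps:
  "Ob (action_groupoid X) = acar X"
  "e \<in> car (Ar (action_groupoid X)) \<longleftrightarrow>
     (\<exists>a g. e = enc (a, g) \<and> a \<in> car (acar X) \<and> g \<in> car (Ar G) \<and> anc X a = src G g)"
  "a \<in> car (acar X) \<Longrightarrow> idt (action_groupoid X) a = enc (a, idt G (anc X a))"
  "a \<in> car (acar X) \<Longrightarrow> g \<in> car (Ar G) \<Longrightarrow> anc X a = src G g \<Longrightarrow>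
     src (action_groupoid X) (enc (a, g)) = a"
  "a \<in> car (acar X) \<Longrightarrow> g \<in> car (Ar G) \<Longrightarrow> anc X a = src G g \<Longrightarrow>
     tgt (action_groupoid X) (enc (a, g)) = aact X (a, g)"
  "a \<in> car (acar X) \<Longrightarrow> g \<in> car (Ar G) \<Longrightarrow> anc X a = src G g \<Longrightarrow>
     ivt (action_groupoid X) (enc (a, g)) = enc (aact X (a, g), ivt G g)"
  "a \<in> car (acar X) \<Longrightarrow> g \<in> car (Ar G) \<Longrightarrow> anc X a = src G g \<Longrightarrow> b = aact X (a, g) \<Longrightarrow>
     b \<in> car (acar X) \<Longrightarrow> h \<in> car (Ar G) \<Longrightarrow> anc X b = src G h \<Longrightarrow>
     cmp (action_groupoid X) (enc (a, g), enc (b, h)) = enc (a, cmp G (g, h))"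
  by (auto simp: action_groupoid_def car_action_arrows)

lemma G_groupoid: "groupoid G"
  using internal by (simp add: internal_groupoid_def)

lemma G_alg: "algebra T (Ob G)" "algebra T (Ar G)"
  using internal by (simp_all add: internal_groupoid_def)

lemma G_preserves:
  "preserves T (Ar G) (Ob G) (src G)" "preserves T (Ar G) (Ob G) (tgt G)"
  "preserves T (Ob G) (Ar G) (idt G)"
  "preserves T (pullback_alg T (Ar G) (Ar G) (tgt G) (src G)) (Ar G) (cmp G)"
  "preserves T (Ar G) (Ar G) (ivt G)"
  using internal by (simp_all add: internal_groupoid_def alg_hom_iff)

lemma action_arrows_alg:
  assumes "action T G X" shows "algebra T (action_arrows X)"
  unfolding action_arrows_def
  using assms G_alg G_preserves inj_enc lawvere
  by (intro algebra_image algebra_pullback[where C = "Ob G"]) (auto simp: action_def alg_hom_iff)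

lemma preserves_dec:
  assumes "action T G X"
  shows "preserves T (action_arrows X) (pullback_alg T (acar X) (Ar G) (anc X) (src G)) dec"
  unfolding action_arrows_def
  using assms G_alg G_preserves inj_enc
  by (intro preserves_inv_image op_closed_pullback[where C = "Ob G"])
     (auto simp: action_def alg_hom_iff intro: algebra_op_closed)

lemmas preserves_fst_dec = preserves_comp[OF preserves_dec preserves_fst]
lemmas preserves_snd_dec = preserves_comp[OF preserves_dec preserves_snd]

text \<open>Every structure map of the action groupoid with values in arrows is seen to be a homomorphism by
  this rule, applied to its two components.\<close>

lemma preserves_enc:
  assumes "preserves T W (acar X) u" "preserves T W (Ar G) v"
    and "\<And>w. w \<in> car W \<Longrightarrow> anc X (u w) = src G (v w)"
  shows "preserves T W (action_arrows X) (\<lambda>w. enc (u w, v w))"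
  unfolding action_arrows_def
  by (intro preserves_comp[OF preserves_pair preserves_image[OF inj_enc]] assms)

lemma preserves_act:
  assumes "action T G X"
  shows "preserves T (action_arrows X) (acar X) (\<lambda>e. aact X (dec e))"
  by (rule preserves_comp[OF preserves_dec[OF assms]]) (use assms in \<open>simp add: action_def alg_hom_iff\<close>)

lemma actD:
  assumes "action T G X"
  shows "a \<in> car (acar X) \<Longrightarrow> anc X a \<in> car (Ob G)"
    and "a \<in> car (acar X) \<Longrightarrow> g \<in> car (Ar G) \<Longrightarrow> anc X a = src G g \<Longrightarrow> aact X (a, g) \<in> car (acar X)"
    and "a \<in> car (acar X) \<Longrightarrow> g \<in> car (Ar G) \<Longrightarrow> anc X a = src G g \<Longrightarrow> anc X (aact X (a, g)) = tgt G g"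
    and "a \<in> car (acar X) \<Longrightarrow> g \<in> car (Ar G) \<Longrightarrow> h \<in> car (Ar G) \<Longrightarrow> anc X a = src G g \<Longrightarrow>
       tgt G g = src G h \<Longrightarrow> aact X (a, cmp G (g, h)) = aact X (aact X (a, g), h)"
    and "a \<in> car (acar X) \<Longrightarrow> aact X (a, idt G (anc X a)) = a"
  using assms by (auto simp: action_def alg_hom_iff preserves_def car_pullback)

lemmas G_gpd [simp] = gpdD[OF G_groupoid]

text \<open>\<open>(ag)g\<inverse> = a (g \<circ> g\<inverse>) = a \<epsilon>(\<omega>(a)) = a\<close>; this makes the inverse \<open>(ag, g\<inverse>)\<close> of the
  arrow \<open>(a, g)\<close> end at \<open>a\<close>.\<close>

lemma action_inverse:
  assumes X: "action T G X" and "a \<in> car (acar X)" "g \<in> car (Ar G)" "anc X a = src G g"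
  shows "aact X (aact X (a, g), ivt G g) = a"
  using actD(4)[OF X assms(2,3) _ assms(4), of "ivt G g"] actD(5)[OF X assms(2)] assms
  by simp

lemma action_groupoid_groupoid:
  assumes X: "action T G X"
  shows "groupoid (action_groupoid X)"
  unfolding groupoid_def
proof (intro conjI ballI impI)
  show "src (action_groupoid X) \<in> car (Ar (action_groupoid X)) \<rightarrow> car (Ob (action_groupoid X))"
    by (auto simp: action_groupoid_simps)
next
  show "tgt (action_groupoid X) \<in> car (Ar (action_groupoid X)) \<rightarrow> car (Ob (action_groupoid X))"
    by (auto simp: action_groupoid_simps actD(2)[OF X])
next
  fix x assume "x \<in> car (Ob (action_groupoid X))"
  then show "idt (action_groupoid X) x \<in> car (Ar (action_groupoid X))"
    "src (action_groupoid X) (idt (action_groupoid X) x) = x"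
    "tgt (action_groupoid X) (idt (action_groupoid X) x) = x"
    by (simp_all add: action_groupoid_simps actD(1,5)[OF X])
next
  fix e e' assume "e \<in> car (Ar (action_groupoid X))" "e' \<in> car (Ar (action_groupoid X))"
    "tgt (action_groupoid X) e = src (action_groupoid X) e'"
  then show "cmp (action_groupoid X) (e, e') \<in> car (Ar (action_groupoid X))"
    "src (action_groupoid X) (cmp (action_groupoid X) (e, e')) = src (action_groupoid X) e"
    "tgt (action_groupoid X) (cmp (action_groupoid X) (e, e')) = tgt (action_groupoid X) e'"
    by (auto simp: action_groupoid_simps actD(2-4)[OF X])
next
  fix e e' e'' assume "e \<in> car (Ar (action_groupoid X))" "e' \<in> car (Ar (action_groupoid X))"
    "e'' \<in> car (Ar (action_groupoid X))"
    "tgt (action_groupoid X) e = src (action_groupoid X) e' \<and>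
     tgt (action_groupoid X) e' = src (action_groupoid X) e''"
  then show "cmp (action_groupoid X) (cmp (action_groupoid X) (e, e'), e'') =
      cmp (action_groupoid X) (e, cmp (action_groupoid X) (e', e''))"
    by (auto simp: action_groupoid_simps actD(2-4)[OF X])
next
  fix e assume "e \<in> car (Ar (action_groupoid X))"
  then obtain a g where e: "e = enc (a, g)"
    and ag: "a \<in> car (acar X)" "g \<in> car (Ar G)" "anc X a = src G g"
    by (auto simp: action_groupoid_simps)
  have a: "aact X (a, idt G (src G g)) = a"
    using actD(5)[OF X ag(1)] ag(3) by simp
  note simps = e ag a action_groupoid_simps actD(2,3)[OF X] action_inverse[OF X]
  show "cmp (action_groupoid X) (idt (action_groupoid X) (src (action_groupoid X) e), e) = e"
    "cmp (action_groupoid X) (e, idt (action_groupoid X) (tgt (action_groupoid X) e)) = e"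
    "ivt (action_groupoid X) e \<in> car (Ar (action_groupoid X))"
    "src (action_groupoid X) (ivt (action_groupoid X) e) = tgt (action_groupoid X) e"
    "tgt (action_groupoid X) (ivt (action_groupoid X) e) = src (action_groupoid X) e"
    "cmp (action_groupoid X) (e, ivt (action_groupoid X) e) =
      idt (action_groupoid X) (src (action_groupoid X) e)"
    "cmp (action_groupoid X) (ivt (action_groupoid X) e, e) =
      idt (action_groupoid X) (tgt (action_groupoid X) e)"
    by (simp_all add: simps)
qed

text \<open>Source and target are composites of a projection, respectively the action, with the decoding of
  arrows. The others are pairings: \<open>a \<mapsto> (a, \<epsilon>(\<omega>(a)))\<close> for identities, \<open>(a, g) \<mapsto> (ag, g\<inverse>)\<close> for
  inversion, and \<open>((a, g), (ag, h)) \<mapsto> (a, g \<circ> h)\<close> for composition, where \<open>(g, h)\<close> lies in the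
  domain of the composition of \<open>G\<close> because \<open>\<omega>(ag) = t(g)\<close>.\<close>

lemma action_groupoid_internal:
  assumes X: "action T G X"
  shows "internal_groupoid T (action_groupoid X)"
proof -
  let ?E = "action_arrows X"
  let ?s = "\<lambda>e\<in>car ?E. fst (dec e)" and ?t = "\<lambda>e\<in>car ?E. aact X (dec e)"
  let ?P = "pullback_alg T ?E ?E ?t ?s"
  have A: "algebra T (acar X)" and anc: "preserves T (acar X) (Ob G) (anc X)"
    using X by (simp_all add: action_def alg_hom_iff)
  note E = action_arrows_alg[OF X]
  note cl = algebra_op_closed[OF A] algebra_op_closed[OF E]
  note p1 = preserves_fst_dec[OF X] and p2 = preserves_snd_dec[OF X] and t = preserves_act[OF X]
  have s': "?s \<in> alg_hom T ?E (acar X)" and t': "?t \<in> alg_hom T ?E (acar X)"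
    using cl p1 t by (auto intro: preserves_restrict)
  have clP: "op_closed T ?P"
    using cl s' t' by (intro op_closed_pullback[where C = "acar X"]) (auto simp: alg_hom_iff)
  have id': "(\<lambda>a\<in>car (acar X). enc (a, idt G (anc X a))) \<in> alg_hom T (acar X) ?E"
    by (intro preserves_restrict cl preserves_enc preserves_ident preserves_comp[OF anc G_preserves(3)])
       (simp add: actD[OF X])
  have inv': "(\<lambda>e\<in>car ?E. enc (aact X (dec e), ivt G (snd (dec e)))) \<in> alg_hom T ?E ?E"
    by (intro preserves_restrict cl preserves_enc t preserves_comp[OF p2 G_preserves(5)])
       (auto simp: actD[OF X] car_action_arrows)
  have "preserves T ?P (pullback_alg T (Ar G) (Ar G) (tgt G) (src G))
      (\<lambda>x. (snd (dec (fst x)), snd (dec (snd x))))"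
    by (intro preserves_pair preserves_comp[OF preserves_fst p2] preserves_comp[OF preserves_snd p2])
       (auto simp: car_pullback car_action_arrows actD[OF X])
  then have c: "preserves T ?P ?E
      (\<lambda>x. enc (fst (dec (fst x)), cmp G (snd (dec (fst x)), snd (dec (snd x)))))"
    by (intro preserves_enc preserves_comp[OF preserves_fst p1] preserves_comp[OF _ G_preserves(4)])
       (auto simp: car_pullback car_action_arrows actD[OF X])
  \<comment> \<open>the domain on which composition was defined is the pullback of target and source\<close>
  have P: "{(e, e'). e \<in> car ?E \<and> e' \<in> car ?E \<and> aact X (dec e) = fst (dec e')} = car ?P"
    by (auto simp: car_pullback)
  have c': "cmp (action_groupoid X) \<in> alg_hom T ?P ?E"
    using preserves_restrict[OF clP c] unfolding action_groupoid_def P by (simp add: case_prod_beta')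
  show ?thesis
    using action_groupoid_groupoid[OF X] A E s' t' id' inv' c'
    unfolding internal_groupoid_def by (simp add: action_groupoid_def)
qed

text \<open>The star of \<open>a\<close> consists of the pairs \<open>(a, g)\<close> with \<open>g\<close> in the star of \<open>\<omega>(a)\<close>, so
  \<open>g \<mapsto> (a, g)\<close> inverts the projection on stars.\<close>

lemma action_projection_covering:
  assumes X: "action T G X"
  shows "action_projection X \<in> igpd_hom T (action_groupoid X) G"
    and "covering (action_groupoid X) G (action_projection X)"
proof -
  have anc: "anc X \<in> alg_hom T (acar X) (Ob G)"
    using X by (simp add: action_def)
  have "(\<lambda>e\<in>car (action_arrows X). snd (dec e)) \<in> alg_hom T (action_arrows X) (Ar G)"
    by (intro preserves_restrict algebra_op_closed action_arrows_alg X preserves_snd_dec)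
  then show "action_projection X \<in> igpd_hom T (action_groupoid X) G"
    using anc unfolding igpd_hom_def action_projection_def
    by (auto simp: action_groupoid_def car_action_arrows actD[OF X])
  show "covering (action_groupoid X) G (action_projection X)"
    unfolding covering_def
  proof
    fix a assume "a \<in> car (Ob (action_groupoid X))"
    then have a: "a \<in> car (acar X)" by (simp add: action_groupoid_def)
    show "bij_betw (snd (action_projection X)) (star (action_groupoid X) a)
        (star G (fst (action_projection X) a))"
      by (rule bij_betw_byWitness[where f' = "\<lambda>g. enc (a, g)"])
        (use a in \<open>auto simp: star_def action_projection_def action_groupoid_def car_action_arrows\<close>)
  qed
qed

section \<open>The action by lifting along a covering\<close>

text \<open>Meaningful when \<open>p\<close> is a covering and \<open>g\<close> starts at the image of \<open>x\<close>: the unique arrow of \<open>H\<close>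
  out of \<open>x\<close> that lies over \<open>g\<close>.\<close>

definition lift :: "('m, 'u) igpd \<Rightarrow> 'u gpd_map \<Rightarrow> 'u \<times> 'u \<Rightarrow> 'u" where
  "lift H p = (\<lambda>(x, g). inv_into (star H x) (snd p) g)"

definition lifting_action :: "('m, 'u) igpd \<times> 'u gpd_map \<Rightarrow> ('m, 'u) act" where
  "lifting_action = (\<lambda>(H, p).
    \<lparr>acar = Ob H, anc = fst p,
     aact = (\<lambda>xg\<in>car (pullback_alg T (Ob H) (Ar G) (fst p) (src G)). tgt H (lift H p xg))\<rparr>)"

definition internal_covering :: "('m, 'u) igpd \<Rightarrow> 'u gpd_map \<Rightarrow> bool" where
  "internal_covering H p \<longleftrightarrow> internal_groupoid T H \<and> p \<in> igpd_hom T H G \<and> covering H G p"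

lemma lift_over:
  assumes c: "internal_covering H p" and x: "x \<in> car (Ob H)" and g: "g \<in> car (Ar G)" "fst p x = src G g"
  shows "lift H p (x, g) \<in> car (Ar H)" "src H (lift H p (x, g)) = x" "snd p (lift H p (x, g)) = g"
proof -
  have b: "bij_betw (snd p) (star H x) (star G (fst p x))"
    using c x by (simp add: internal_covering_def covering_def)
  have "g \<in> snd p ` star H x"
    using b g by (simp add: bij_betw_def star_def)
  then have "lift H p (x, g) \<in> star H x" "snd p (lift H p (x, g)) = g"
    by (simp_all add: lift_def inv_into_into f_inv_into_f)
  then show "lift H p (x, g) \<in> car (Ar H)" "src H (lift H p (x, g)) = x" "snd p (lift H p (x, g)) = g"
    by (simp_all add: star_def)
qed

lemma covD:
  assumes "internal_covering H p"
  shows "groupoid H" "algebra T (Ob H)" "algebra T (Ar H)"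
    "preserves T (Ob H) (Ob G) (fst p)" "preserves T (Ar H) (Ar G) (snd p)"
    "preserves T (Ar H) (Ob H) (src H)" "preserves T (Ar H) (Ob H) (tgt H)"
    "fst p \<in> extensional (car (Ob H))" "snd p \<in> extensional (car (Ar H))"
    "x \<in> car (Ob H) \<Longrightarrow> fst p x \<in> car (Ob G)" "h \<in> car (Ar H) \<Longrightarrow> snd p h \<in> car (Ar G)"
    "h \<in> car (Ar H) \<Longrightarrow> src G (snd p h) = fst p (src H h)"
    "h \<in> car (Ar H) \<Longrightarrow> tgt G (snd p h) = fst p (tgt H h)"
    "x \<in> car (Ob H) \<Longrightarrow> snd p (idt H x) = idt G (fst p x)"
    "h \<in> car (Ar H) \<Longrightarrow> k \<in> car (Ar H) \<Longrightarrow> tgt H h = src H k \<Longrightarrow>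
        snd p (cmp H (h, k)) = cmp G (snd p h, snd p k)"
  using assms
  by (auto simp: internal_covering_def internal_groupoid_def igpd_hom_def alg_hom_iff preserves_def split_beta)

lemma lift_unique:
  assumes c: "internal_covering H p" and h: "h \<in> car (Ar H)" "src H h = x" "snd p h = g"
  shows "lift H p (x, g) = h"
proof -
  have "x \<in> car (Ob H)"
    using gpdD(1)[OF covD(1)[OF c] h(1)] h(2) by simp
  then have "inj_on (snd p) (star H x)"
    using c by (simp add: internal_covering_def covering_def bij_betw_def)
  then show ?thesis
    using h inv_into_f_f[of "snd p" "star H x" h] by (simp add: lift_def star_def)
qed

lemma tgt_lift:
  assumes c: "internal_covering H p" and h: "x \<in> car (Ob H)" "g \<in> car (Ar G)" "fst p x = src G g"
  shows "fst p (tgt H (lift H p (x, g))) = tgt G g"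
  using covD(13)[OF c lift_over(1)[OF c h]] lift_over(3)[OF c h] by simp

text \<open>The composite on the right starts at \<open>x\<close> and lies over \<open>g \<circ> h\<close>, so it is the lift of
  \<open>g \<circ> h\<close> at \<open>x\<close>.\<close>

lemma lift_cmp:
  assumes c: "internal_covering H p"
    and h: "x \<in> car (Ob H)" "g \<in> car (Ar G)" "fst p x = src G g" "h \<in> car (Ar G)" "tgt G g = src G h"
  shows "lift H p (x, cmp G (g, h)) = cmp H (lift H p (x, g), lift H p (tgt H (lift H p (x, g)), h))"
proof (rule lift_unique[OF c])
  note cov = covD[OF c] and gpd = gpdD[OF covD(1)[OF c]]
  let ?y = "tgt H (lift H p (x, g))"
  have y: "?y \<in> car (Ob H)" "fst p ?y = src G h"
    using h tgt_lift[OF c h(1-3)] lift_over(1)[OF c h(1-3)] gpd(2) by simp_all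
  note l = lift_over[OF c h(1-3)] lift_over[OF c y(1) h(4) y(2)]
  show "cmp H (lift H p (x, g), lift H p (?y, h)) \<in> car (Ar H)"
    "src H (cmp H (lift H p (x, g), lift H p (?y, h))) = x"
    "snd p (cmp H (lift H p (x, g), lift H p (?y, h))) = cmp G (g, h)"
    using l by (simp_all add: gpd cov)
qed

lemma lift_idt:
  assumes c: "internal_covering H p" and x: "x \<in> car (Ob H)"
  shows "lift H p (x, idt G (fst p x)) = idt H x"
  using x by (intro lift_unique[OF c]) (simp_all add: covD[OF c] gpdD[OF covD(1)[OF c]])

text \<open>The one place where being a covering meets the algebraic structure: the lifting map is the inverse
  of the bijective homomorphism \<open>h \<mapsto> (s(h), p(h))\<close>.\<close>

lemma preserves_lift:
  assumes c: "internal_covering H p"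
  shows "preserves T (pullback_alg T (Ob H) (Ar G) (fst p) (src G)) (Ar H) (lift H p)"
proof (rule preserves_inverse[where k = "\<lambda>h. (src H h, snd p h)"])
  show "op_closed T (Ar H)"
    using covD(3)[OF c] by (rule algebra_op_closed)
  show "preserves T (Ar H) (pullback_alg T (Ob H) (Ar G) (fst p) (src G)) (\<lambda>h. (src H h, snd p h))"
    by (intro preserves_pair) (simp_all add: covD[OF c])
qed (auto simp: car_pullback lift_over[OF c] lift_unique[OF c])

lemma lifting_action_action:
  assumes c: "internal_covering H p"
  shows "action T G (lifting_action (H, p))"
proof -
  note cov = covD[OF c] and gpd = gpdD[OF covD(1)[OF c]]
  let ?P = "pullback_alg T (Ob H) (Ar G) (fst p) (src G)"
  have clP: "op_closed T ?P"
    using cov(2,4) G_alg(2) G_preserves(1) by (intro op_closed_pullback) (auto intro: algebra_op_closed)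
  have act: "(\<lambda>xg\<in>car ?P. tgt H (lift H p xg)) \<in> alg_hom T ?P (Ob H)"
    by (intro preserves_restrict clP preserves_comp[OF preserves_lift[OF c] cov(7)])
  have ext: "fst p \<in> alg_hom T (Ob H) (Ob G)"
    using cov by (simp add: alg_hom_iff)
  show ?thesis
    unfolding action_def lifting_action_def
    using cov(2) act ext tgt_lift[OF c] lift_cmp[OF c] lift_idt[OF c]
    by (auto simp: car_pullback gpd cov lift_over[OF c])
qed

section \<open>The categories of actions and of coverings\<close>

lemma act_category: "category (act_cat T G)"
  unfolding category_def
proof (intro conjI ballI; simp add: act_cat_def)
  fix X assume "action T G X"
  then show "restrict (\<lambda>a. a) (car (acar X)) \<in> act_hom T G X X"
    unfolding act_hom_def
    by (auto simp: actD intro!: preserves_restrict preserves_ident algebra_op_closed) (simp add: action_def)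
next
  fix X Y Z f g
  assume h: "action T G X" "action T G Y" "action T G Z" "f \<in> act_hom T G X Y" "g \<in> act_hom T G Y Z"
  have "algebra T (acar X)" using h by (simp add: action_def)
  then show "compose (car (acar X)) g f \<in> act_hom T G X Z"
    using h unfolding act_hom_def
    by (auto simp: actD compose_eq intro!: alg_hom_compose algebra_op_closed)
       (auto simp: alg_hom_iff preserves_def compose_eq actD Pi_iff)
next
  fix X Y f assume "f \<in> act_hom T G X Y"
  then show "compose (car (acar X)) f (restrict (\<lambda>a. a) (car (acar X))) = f"
    and "compose (car (acar X)) (restrict (\<lambda>a. a) (car (acar Y))) f = f"
    by (auto simp: act_hom_def alg_hom_iff preserves_def compose_def extensional_def fun_eq_iff Pi_iff)
next
  fix W X Y Z f g h assume "f \<in> act_hom T G W X"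
  then show "compose (car (acar W)) (compose (car (acar X)) h g) f =
      compose (car (acar W)) h (compose (car (acar W)) g f)"
    by (auto simp: act_hom_def alg_hom_iff preserves_def compose_def fun_eq_iff Pi_iff)
qed

lemma cov_cat_simps:
  "(H, p) \<in> obj (cov_cat T G) \<longleftrightarrow> internal_covering H p"
  "f \<in> hom (cov_cat T G) (H, p) (K, q) \<longleftrightarrow> f \<in> igpd_hom T H K \<and> igpd_compose H q f = p"
  "ide (cov_cat T G) (H, p) = igpd_ident H"
  "comp (cov_cat T G) (H, p) (K, q) (L, r) g f = igpd_compose H g f"
  by (simp_all add: cov_cat_def internal_covering_def igpd_ident_def)

lemma act_cat_simps:
  "X \<in> obj (act_cat T G) \<longleftrightarrow> action T G X"
  "hom (act_cat T G) = act_hom T G"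
  "ide (act_cat T G) X = restrict (\<lambda>a. a) (car (acar X))"
  "comp (act_cat T G) X Y Z g f = compose (car (acar X)) g f"
  by (simp_all add: act_cat_def)

lemma cov_category: "category (cov_cat T G)"
proof -
  have ident: "igpd_compose H p (igpd_ident H) = p" and int: "internal_groupoid T H"
    if "internal_covering H p" for H p
    using that igpd_compose_laws(1)[of p T H G] by (simp_all add: internal_covering_def)
  have over: "igpd_compose H r (igpd_compose H g f) = p"
    if "f \<in> igpd_hom T H K" "igpd_compose H q f = p" "igpd_compose K r g = q" for H K :: "('m, 'u) igpd" and p q r f g
    using igpd_compose_laws(3)[OF that(1), of r g] that by simp
  show ?thesis
    unfolding category_def
  proof (intro conjI ballI)
    fix X assume "X \<in> obj (cov_cat T G)"
    then show "ide (cov_cat T G) X \<in> hom (cov_cat T G) X X"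
      by (cases X) (simp add: cov_cat_simps igpd_ident_hom ident int)
  next
    fix X Y Z f g assume "X \<in> obj (cov_cat T G)"
      "f \<in> hom (cov_cat T G) X Y" "g \<in> hom (cov_cat T G) Y Z"
    then show "comp (cov_cat T G) X Y Z g f \<in> hom (cov_cat T G) X Z"
      by (cases X; cases Y; cases Z) (auto simp only: cov_cat_simps over int intro!: igpd_compose_hom)
  next
    fix X Y f assume "f \<in> hom (cov_cat T G) X Y"
    then show "comp (cov_cat T G) X X Y f (ide (cov_cat T G) X) = f"
      "comp (cov_cat T G) X Y Y (ide (cov_cat T G) Y) f = f"
      by (cases X; cases Y; auto simp only: cov_cat_simps dest: igpd_compose_laws(1,2))+
  next
    fix W X Y Z f g h assume "f \<in> hom (cov_cat T G) W X"
    then show "comp (cov_cat T G) W X Z (comp (cov_cat T G) X Y Z h g) f =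
        comp (cov_cat T G) W Y Z h (comp (cov_cat T G) W X Y g f)"
      by (cases W; cases X; cases Y; cases Z) (auto simp only: cov_cat_simps dest: igpd_compose_laws(3))
  qed
qed

lemma act_homD:
  assumes "f \<in> act_hom T G X Y"
  shows "preserves T (acar X) (acar Y) f" "f \<in> extensional (car (acar X))"
    "a \<in> car (acar X) \<Longrightarrow> f a \<in> car (acar Y)"
    "a \<in> car (acar X) \<Longrightarrow> anc Y (f a) = anc X a"
    "a \<in> car (acar X) \<Longrightarrow> g \<in> car (Ar G) \<Longrightarrow> anc X a = src G g \<Longrightarrow>
       f (aact X (a, g)) = aact Y (f a, g)"
  using assms by (auto simp: act_hom_def alg_hom_iff preserves_def)

section \<open>The two functors\<close>

lemma action_groupoid_covering:
  "action T G X \<Longrightarrow> internal_covering (action_groupoid X) (action_projection X)"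
  by (simp add: internal_covering_def action_groupoid_internal action_projection_covering)

lemma Ar_action_groupoid: "Ar (action_groupoid X) = action_arrows X"
  by (simp add: action_groupoid_def)

lemma action_map_hom:
  assumes X: "action T G X" and Y: "action T G Y" and f: "f \<in> act_hom T G X Y"
  shows "action_map X f \<in> igpd_hom T (action_groupoid X) (action_groupoid Y)"
    and "igpd_compose (action_groupoid X) (action_projection Y) (action_map X f) = action_projection X"
proof -
  note fD = act_homD[OF f]
  have "(\<lambda>e\<in>car (action_arrows X). enc (f (fst (dec e)), snd (dec e)))
      \<in> alg_hom T (action_arrows X) (action_arrows Y)"
    by (intro preserves_restrict algebra_op_closed action_arrows_alg X preserves_enc
          preserves_comp[OF preserves_fst_dec[OF X] fD(1)] preserves_snd_dec)
       (auto simp: car_action_arrows fD)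
  then show "action_map X f \<in> igpd_hom T (action_groupoid X) (action_groupoid Y)"
    using fD
    by (intro igpd_homI)
       (auto simp: action_map_def action_groupoid_simps Ar_action_groupoid[symmetric] alg_hom_iff
         actD(1-3)[OF X] actD(2,3)[OF Y])
  show "igpd_compose (action_groupoid X) (action_projection Y) (action_map X f) = action_projection X"
    by (rule gpd_map_eqI[where A = "car (acar X)" and B = "car (action_arrows X)"])
       (use X fD in \<open>auto simp: igpd_compose_def compose_eq action_map_def action_projection_def
          action_groupoid_simps Ar_action_groupoid car_action_arrows action_def alg_hom_iff\<close>)
qed

text \<open>\<open>f\<close> maps the lift of \<open>g\<close> at \<open>x\<close> to an arrow out of \<open>f(x)\<close> over \<open>g\<close>. Hence a morphism of coverings is
  equivariant on objects, and it commutes with the counit.\<close>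

lemma lift_natural:
  assumes H: "internal_covering H p" and K: "internal_covering K q"
    and f: "f \<in> igpd_hom T H K" and qf: "igpd_compose H q f = p"
    and xg: "x \<in> car (Ob H)" "g \<in> car (Ar G)" "fst p x = src G g"
  shows "snd f (lift H p (x, g)) = lift K q (fst f x, g)"
proof -
  note l = lift_over[OF H xg] and fD = igpd_homD[OF f]
  have "snd q (snd f (lift H p (x, g))) = g"
    using igpd_compose_simps(2)[OF l(1), of q f] l(3) qf by simp
  then show ?thesis
    using l by (intro lift_unique[OF K, symmetric]) (simp_all add: fD)
qed

lemma lifting_action_simps:
  "acar (lifting_action (H, p)) = Ob H" "anc (lifting_action (H, p)) = fst p"
  "x \<in> car (Ob H) \<Longrightarrow> g \<in> car (Ar G) \<Longrightarrow> fst p x = src G g \<Longrightarrow>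
     aact (lifting_action (H, p)) (x, g) = tgt H (lift H p (x, g))"
  by (simp_all add: lifting_action_def car_pullback)

lemma lifting_action_hom:
  assumes H: "internal_covering H p" and K: "internal_covering K q"
    and f: "f \<in> igpd_hom T H K" and qf: "igpd_compose H q f = p"
  shows "fst f \<in> act_hom T G (lifting_action (H, p)) (lifting_action (K, q))"
proof -
  note fD = igpd_homD[OF f]
  have pq: "fst q (fst f x) = fst p x" if "x \<in> car (Ob H)" for x
    using igpd_compose_simps(1)[OF that, of q f] qf by simp
  show ?thesis
    using fD pq
    by (auto simp: act_hom_def lifting_action_simps alg_hom_iff lift_over[OF H]
        lift_natural[OF H K f qf, symmetric])
qed

lemma action_groupoid_functor:
  "is_functor (act_cat T G) (cov_cat T G)
     (\<lambda>X. (action_groupoid X, action_projection X)) (\<lambda>X Y. action_map X)"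
proof -
  have id: "action_map X (restrict (\<lambda>a. a) (car (acar X))) = igpd_ident (action_groupoid X)" for X
    by (rule gpd_map_eqI[where A = "car (acar X)" and B = "car (action_arrows X)"])
       (auto simp: action_map_def igpd_ident_def action_groupoid_simps(1) Ar_action_groupoid car_action_arrows)
  have "action_map X (compose (car (acar X)) g f) =
      igpd_compose (action_groupoid X) (action_map Y g) (action_map X f)"
    if f: "f \<in> act_hom T G X Y" for X Y f g
    by (rule gpd_map_eqI[where A = "car (acar X)" and B = "car (action_arrows X)"])
       (auto simp: action_map_def igpd_compose_def compose_eq action_groupoid_simps(1) Ar_action_groupoid
          car_action_arrows act_homD[OF f])
  then show ?thesis
    unfolding is_functor_def
    by (simp add: act_category cov_category cov_cat_simps act_cat_simps action_groupoid_covering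
        action_map_hom id)
qed

lemma lifting_action_functor:
  "is_functor (cov_cat T G) (act_cat T G) lifting_action (\<lambda>_ _. fst)"
proof -
  have "fst f \<in> act_hom T G (lifting_action (H, p)) (lifting_action (K, q))"
    if "internal_covering H p" "internal_covering K q" "f \<in> hom (cov_cat T G) (H, p) (K, q)" for H p K q f
    using that lifting_action_hom by (simp add: cov_cat_simps)
  then show ?thesis
    unfolding is_functor_def split_paired_all
    by (auto simp: act_category cov_category cov_cat_simps(1,3,4) act_cat_simps lifting_action_action
        igpd_ident_def lifting_action_simps igpd_compose_def)
qed

section \<open>The unit and the counit\<close>

lemma lift_action_groupoid:
  assumes X: "action T G X" and "a \<in> car (acar X)" "g \<in> car (Ar G)" "anc X a = src G g"
  shows "lift (action_groupoid X) (action_projection X) (a, g) = enc (a, g)"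
  using assms(2-4)
  by (intro lift_unique[OF action_groupoid_covering[OF X]])
     (auto simp: action_groupoid_simps action_projection_def car_action_arrows)

text \<open>The lift of \<open>g\<close> at \<open>a\<close> is the arrow \<open>(a, g)\<close>, whose target is \<open>ag\<close>. The result is an equality of
  records because the action map of an action is extensional on its pullback.\<close>

lemma lifting_action_of_action_groupoid:
  assumes X: "action T G X"
  shows "lifting_action (action_groupoid X, action_projection X) = X"
proof -
  have "aact (lifting_action (action_groupoid X, action_projection X)) = aact X"
  proof (rule extensionalityI[where A = "car (pullback_alg T (acar X) (Ar G) (anc X) (src G))"])
    show "aact (lifting_action (action_groupoid X, action_projection X))
        \<in> extensional (car (pullback_alg T (acar X) (Ar G) (anc X) (src G)))"
      by (simp add: lifting_action_def action_groupoid_def action_projection_def)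
    show "aact X \<in> extensional (car (pullback_alg T (acar X) (Ar G) (anc X) (src G)))"
      using X by (simp add: action_def alg_hom_iff)
  next
    fix y assume "y \<in> car (pullback_alg T (acar X) (Ar G) (anc X) (src G))"
    then obtain a g where "y = (a, g)" "a \<in> car (acar X)" "g \<in> car (Ar G)" "anc X a = src G g"
      by (auto simp: car_pullback)
    then show "aact (lifting_action (action_groupoid X, action_projection X)) y = aact X y"
      by (simp add: lifting_action_def car_pullback action_groupoid_simps(1) action_projection_def
          lift_action_groupoid[OF X, unfolded action_projection_def] action_groupoid_simps(5))
  qed
  then show ?thesis
    by (simp add: lifting_action_simps action_groupoid_simps action_projection_def)
qed

text \<open>The comparison from the action groupoid of the lifting action back to \<open>H\<close>: the identity on
  objects, and \<open>(x, g) \<mapsto>\<close> lift of \<open>g\<close> at \<open>x\<close> on arrows. Its inverse sends an arrow \<open>h\<close> to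
  \<open>(s(h), p(h))\<close>.\<close>

definition counit :: "('m, 'u) igpd \<Rightarrow> 'u gpd_map \<Rightarrow> 'u gpd_map" where
  "counit H p = (\<lambda>x\<in>car (Ob H). x, \<lambda>e\<in>car (action_arrows (lifting_action (H, p))). lift H p (dec e))"

definition counit_inverse :: "('m, 'u) igpd \<Rightarrow> 'u gpd_map \<Rightarrow> 'u gpd_map" where
  "counit_inverse H p = (\<lambda>x\<in>car (Ob H). x, \<lambda>h\<in>car (Ar H). enc (src H h, snd p h))"

abbreviation reconstruction :: "('m, 'u) igpd \<Rightarrow> 'u gpd_map \<Rightarrow> ('m, 'u) igpd \<times> 'u gpd_map" where
  "reconstruction H p \<equiv>
    (action_groupoid (lifting_action (H, p)), action_projection (lifting_action (H, p)))"

lemma counit_hom: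
  assumes H: "internal_covering H p"
  shows "counit H p \<in> hom (cov_cat T G) (reconstruction H p) (H, p)"
proof -
  let ?X = "lifting_action (H, p)"
  note X = lifting_action_action[OF H] and cov = covD[OF H]
  have 1: "(\<lambda>e\<in>car (action_arrows ?X). lift H p (dec e)) \<in> alg_hom T (action_arrows ?X) (Ar H)"
    using preserves_comp[OF preserves_dec[OF X], unfolded lifting_action_simps, OF preserves_lift[OF H]]
    by (intro preserves_restrict algebra_op_closed action_arrows_alg X)
  have 0: "(\<lambda>x\<in>car (Ob H). x) \<in> alg_hom T (Ob H) (Ob H)"
    by (intro preserves_restrict preserves_ident algebra_op_closed cov)
  have "counit H p \<in> igpd_hom T (action_groupoid ?X) H"
    by (rule igpd_homI)
       (use 0 1 in \<open>auto simp: counit_def Ar_action_groupoid[symmetric] action_groupoid_simps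
          lifting_action_simps lift_over[OF H] lift_idt[OF H] lift_cmp[OF H] tgt_lift[OF H] cov gpdD[OF cov(1)]\<close>)
  moreover have "igpd_compose (action_groupoid ?X) p (counit H p) = action_projection ?X"
    by (rule gpd_map_eqI[where A = "car (Ob H)" and B = "car (action_arrows ?X)"])
       (auto simp: igpd_compose_def compose_eq counit_def action_projection_def lifting_action_simps
          action_groupoid_simps(1) Ar_action_groupoid car_action_arrows lift_over[OF H] cov)
  ultimately show ?thesis
    by (simp add: cov_cat_simps)
qed

lemma counit_inverse_hom:
  assumes H: "internal_covering H p"
  shows "counit_inverse H p \<in> hom (cov_cat T G) (H, p) (reconstruction H p)"
proof -
  let ?X = "lifting_action (H, p)"
  note cov = covD[OF H]
  have 1: "(\<lambda>h\<in>car (Ar H). enc (src H h, snd p h)) \<in> alg_hom T (Ar H) (action_arrows ?X)"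
    by (intro preserves_restrict algebra_op_closed cov preserves_enc) (simp_all add: lifting_action_simps cov)
  have 0: "(\<lambda>x\<in>car (Ob H). x) \<in> alg_hom T (Ob H) (Ob H)"
    by (intro preserves_restrict preserves_ident algebra_op_closed cov)
  have "counit_inverse H p \<in> igpd_hom T H (action_groupoid ?X)"
    by (rule igpd_homI)
       (use 0 1 in \<open>auto simp: counit_inverse_def Ar_action_groupoid action_groupoid_simps
          lifting_action_simps lift_unique[OF H] cov gpdD[OF cov(1)]\<close>)
  moreover have "igpd_compose H (action_projection ?X) (counit_inverse H p) = p"
    by (rule gpd_map_eqI[where A = "car (Ob H)" and B = "car (Ar H)"])
       (auto simp: igpd_compose_simps counit_inverse_def action_projection_def lifting_action_simps
          car_action_arrows cov gpdD[OF cov(1)])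
  ultimately show ?thesis
    by (simp add: cov_cat_simps)
qed

lemma counit_iso:
  assumes H: "internal_covering H p"
  shows "iso (cov_cat T G) (reconstruction H p) (H, p) (counit H p)"
proof -
  let ?X = "lifting_action (H, p)"
  note cov = covD[OF H]
  have "igpd_compose (action_groupoid ?X) (counit_inverse H p) (counit H p) = igpd_ident (action_groupoid ?X)"
    by (rule gpd_map_eqI[where A = "car (Ob H)" and B = "car (action_arrows ?X)"])
       (auto simp: igpd_compose_def compose_eq counit_def counit_inverse_def igpd_ident_def
          lifting_action_simps action_groupoid_simps(1) Ar_action_groupoid car_action_arrows lift_over[OF H])
  moreover have "igpd_compose H (counit H p) (counit_inverse H p) = igpd_ident H"
    by (rule gpd_map_eqI[where A = "car (Ob H)" and B = "car (Ar H)"])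
       (auto simp: igpd_compose_simps counit_def counit_inverse_def igpd_ident_def
          lifting_action_simps car_action_arrows lift_unique[OF H] cov gpdD[OF cov(1)])
  ultimately show ?thesis
    unfolding iso_def using counit_hom[OF H] counit_inverse_hom[OF H]
    by (auto simp: cov_cat_simps)
qed

lemma counit_natural:
  assumes H: "internal_covering H p" and K: "internal_covering K q"
    and f: "f \<in> igpd_hom T H K" and qf: "igpd_compose H q f = p"
  shows "igpd_compose (action_groupoid (lifting_action (H, p))) (counit K q)
      (action_map (lifting_action (H, p)) (fst f)) =
    igpd_compose (action_groupoid (lifting_action (H, p))) f (counit H p)"
proof -
  let ?X = "lifting_action (H, p)"
  note fD = igpd_homD[OF f]
  have pq: "fst q (fst f x) = fst p x" if "x \<in> car (Ob H)" for x
    using igpd_compose_simps(1)[OF that, of q f] qf by simp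
  show ?thesis
    by (rule gpd_map_eqI[where A = "car (Ob H)" and B = "car (action_arrows ?X)"])
       (auto simp: igpd_compose_def compose_eq counit_def action_map_def fD pq
          lifting_action_simps action_groupoid_simps(1) Ar_action_groupoid car_action_arrows
          lift_natural[OF H K f qf])
qed

lemma act_cat_equivalent_cov_cat: "equivalent_categories (act_cat T G) (cov_cat T G)"
proof -
  let ?F = "\<lambda>X. (action_groupoid X, action_projection X)"
  have "natural_iso (act_cat T G) (act_cat T G) (\<lambda>X. X) (\<lambda>X Y f. f)
      (\<lambda>X. lifting_action (?F X)) (\<lambda>X Y f. fst (action_map X f)) (ide (act_cat T G))"
    using act_category unfolding category_def natural_iso_def iso_def
    by (simp add: act_cat_simps(1) lifting_action_of_action_groupoid action_map_def)
  moreover have "natural_iso (cov_cat T G) (cov_cat T G)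
      (\<lambda>Y. ?F (lifting_action Y)) (\<lambda>Y Z f. action_map (lifting_action Y) (fst f))
      (\<lambda>Y. Y) (\<lambda>Y Z f. f) (\<lambda>(H, p). counit H p)"
    unfolding natural_iso_def
  proof (intro conjI ballI)
    fix Y assume "Y \<in> obj (cov_cat T G)"
    then show "iso (cov_cat T G) (?F (lifting_action Y)) Y (case Y of (H, p) \<Rightarrow> counit H p)"
      by (cases Y) (simp add: cov_cat_simps counit_iso)
  next
    fix Y Z f assume "Y \<in> obj (cov_cat T G)" "Z \<in> obj (cov_cat T G)" "f \<in> hom (cov_cat T G) Y Z"
    then show "comp (cov_cat T G) (?F (lifting_action Y)) (?F (lifting_action Z)) Z
        (case Z of (H, p) \<Rightarrow> counit H p) (action_map (lifting_action Y) (fst f)) =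
      comp (cov_cat T G) (?F (lifting_action Y)) Y Z f (case Y of (H, p) \<Rightarrow> counit H p)"
      by (cases Y; cases Z) (simp add: cov_cat_simps counit_natural)
  qed
  ultimately show ?thesis
    unfolding equivalent_categories_def
    using action_groupoid_functor lifting_action_functor by blast
qed

end

lemma infinite_pairing:
  assumes "infinite (UNIV :: 'u set)"
  obtains enc :: "'u \<times> 'u \<Rightarrow> 'u" where "inj enc"
proof -
  have "\<exists>enc. bij_betw enc (UNIV \<times> UNIV :: ('u \<times> 'u) set) (UNIV :: 'u set)"
    using card_of_Times_same_infinite[OF assms] by (simp only: card_of_ordIso)
  then obtain enc :: "'u \<times> 'u \<Rightarrow> 'u" where "bij_betw enc (UNIV \<times> UNIV) UNIV"
    by blast
  then show ?thesis
    using that[of enc] by (simp add: bij_betw_def)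
qed

theorem theorem4p13:
  fixes T :: "'m lawvere" and G :: "('m, 'u) igpd"
  assumes "infinite (UNIV :: 'u set)"
    and "semi_abelian_theory TYPE('u) T"
    and "internal_groupoid T G"
  shows "equivalent_categories (act_cat T G) (cov_cat T G)"
proof -
  obtain enc :: "'u \<times> 'u \<Rightarrow> 'u" where "inj enc"
    using infinite_pairing[OF assms(1)] .
  then interpret encoded_internal_groupoid T G enc
    using assms by unfold_locales (simp_all add: semi_abelian_theory_def)
  show ?thesis
    by (rule act_cat_equivalent_cov_cat)
qed

end
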